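(* Let $q,r\in\mathbb R^4$ and let $\Omega,\Xi\subset\mathbb H\cong\mathbb R^4$ be two conformally equivalent domains, with $T(\Xi)=\Omega$ for a Möbius transformation $T(x)=(ax+b)(cx+d)^{-1}$. Consider the three real normed function spaces $CB_{\lambda_q}(\Omega)$, $CB^{\delta_{T,r}}_{\gamma_{T,r,q}}(\Omega)$ and $CB^q_{\rho_T}(\Xi)$ defined in the context. Each of them is a real Banach space and has a four-tuple of reproducing functions with the projection property. That is, if $X$ denotes any one of the three spaces, on its domain $D$ ($D=\Omega$, $\Omega$, $\Xi$ respectively) with weight $w$ ($w=e^{2\langle q,\cdot\rangle}$, $\gamma_{T,r,q}$, $\rho_T$ respectively), then there are real-valued functions $B_0,B_1,B_2,B_3$ on $D\times D$ such that for each $x\in D$ one has $(B_0(x,\cdot),-B_1(x,\cdot),-B_2(x,\cdot),-B_3(x,\cdot))\in X$ and $$\langle(B_0(x,\cdot),-B_1(x,\cdot),-B_2(x,\cdot),-B_3(x,\cdot)),(f_0,f_1,f_2,f_3)\rangle_X=(f_0(x),f_1(x),f_2(x),f_3(x))$$ for all $(f_0,f_1,f_2,f_3)\in X$; moreover, if $g_0,g_1,g_2,g_3:D\to\mathbb R$ are measurable with $\int_D|g_k|^2w\,d\mu<\infty$ for $k=0,1,2,3$, then the four-tuple $(h_0,h_1,h_2,h_3)$ defined by $$(h_0(x),h_1(x),h_2(x),h_3(x))=\langle(B_0(x,\cdot),-B_1(x,\cdot),-B_2(x,\cdot),-B_3(x,\cdot)),(g_0,g_1,g_2,g_3)\rangle_X,\quad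 x\in D,$$ belongs to $X$.
   Context: $\mathbb H$ denotes the quaternions with units $e_1,e_2,e_3$, $e_1e_2=e_3$, $e_2e_3=e_1$, $e_3e_1=e_2$, $e_k^2=-1$. Points $x\in\mathbb R^4$ and parameters $q,r\in\mathbb R^4$ are identified with quaternions through $\psi=\{1,e_1,-e_2,e_3\}$: $x\leftrightarrow x_0+x_1e_1-x_2e_2+x_3e_3$, likewise $q,r$; $\langle q,x\rangle=\sum_kq_kx_k$; $\mu$ is Lebesgue measure. In the formulas for $T,\delta_{T,r},\rho_T$ the symbols $x,y,r$ denote these quaternions. Systems. For a function $\delta=\delta^0+\delta^1e_1-\delta^2e_2+\delta^3e_3$ (with $\delta^n$ real-valued), the inhomogeneous Cimmino system with coefficient $\delta$ for real-valued $C^1$ functions $(f_0,f_1,f_2,f_3)$ is $$\begin{cases} \dfrac{\partial f_0}{\partial x_0}+\dfrac{\partial f_2}{\partial x_2}-\dfrac{\partial f_1}{\partial x_1}-\dfrac{\partial f_3}{\partial x_3}=-(\delta^0f_0+\delta^2f_2-\delta^1f_1-\delta^3f_3)\\[2mm] \dfrac{\partial f_0}{\partial x_1}+\dfrac{\partial f_1}{\partial x_0}-\dfrac{\partial f_2}{\partial x_3}-\dfrac{\partial f_3}{\partial x_2}=-(\delta^1f_0+\delta^0f_1-\delta^3f_2-\delta^2f_3)\\[2mm] \dfrac{\partial f_0}{\partial x_2}+\dfrac{\partial f_3}{\partial x_1}-\dfrac{\partial f_1}{\partial x_3}-\dfrac{\partial f_2}{\partial x_0}=-(\delta^2f_0+\delta^1f_3-\delta^3f_1-\delta^0f_2)\\[2mm]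 \dfrac{\partial f_0}{\partial x_3}+\dfrac{\partial f_1}{\partial x_2}+\dfrac{\partial f_2}{\partial x_1}+\dfrac{\partial f_3}{\partial x_0}=-(\delta^3f_0+\delta^2f_1+\delta^1f_2+\delta^0f_3), \end{cases}$$ i.e. ${}^\psi\mathcal D[f]+\delta f=0$ with $f=f_0+f_1e_1+f_2e_2+f_3e_3$ and ${}^\psi\mathcal D=\frac{\partial}{\partial x_0}+e_1\frac{\partial}{\partial x_1}-e_2\frac{\partial}{\partial x_2}+e_3\frac{\partial}{\partial x_3}$. For constants $\delta^n=q_n$ it is called the system with parameter $q$. Möbius data. $T(x)=(ax+b)(cx+d)^{-1}$, $a,b,c,d\in\mathbb H$, with $a\neq0$ (and $d\ne0$) if $c=0$, and $V:=b-ac^{-1}d\ne0$ if $c\ne0$; $T$ is finite on $\Xi$ and maps it bijectively onto $\Omega$. For $y\in\Omega$: $\delta_{T,r}(y)=(\bar a)^{-1}r\bar d$ if $c=0$, and $\delta_{T,r}(y)=-\dfrac{(y-ac^{-1})\,c\,r\,\overline V\,(y-ac^{-1})}{|c|^2|y-ac^{-1}|^4}$ if $c\neq0$; $\gamma_{T,r,q}(y)=e^{2\langle r-q,T^{-1}(y)\rangle}$. For $x\in\Xi$: $\rho_T(x)=1$ if $c=0$ and $\rho_T(x)=|cxV^{-1}+dV^{-1}|^{-2}$ if $c\neq0$. Spaces (all four-tuples of real-valued $C^1$ functions on the indicated domain): - $CB_{\lambda_q}(\Omega)$: solutions on $\Omega$ of the system with parameter $q$ with $\int_\Omega|f_k(x)|^2e^{2\langle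 q,x\rangle}d\mu_x<\infty$, $k=0,1,2,3$. - $CB^{\delta_{T,r}}_{\gamma_{T,r,q}}(\Omega)$: solutions on $\Omega$ of the system with coefficient $\delta_{T,r}$ with $\int_\Omega|f_k|^2\gamma_{T,r,q}d\mu<\infty$, $k=0,1,2,3$. - $CB^q_{\rho_T}(\Xi)$: solutions on $\Xi$ of the system with parameter $q$ with $\int_\Xi|f_k|^2\rho_Td\mu<\infty$, $k=0,1,2,3$. For each such space $X$ on domain $D$ with weight $w$, the norm is $\|f\|_X=\left[\int_D(f_0^2+f_1^2+f_2^2+f_3^2)w\,d\mu\right]^{1/2}$ and the $\mathbb R^4$-valued real-bilinear form is $$\langle f,g\rangle_X=\Big(\int_D(f_0g_0+f_1g_1+f_2g_2+f_3g_3)w\,d\mu,\ \int_D(f_0g_1-f_1g_0-f_2g_3+f_3g_2)w\,d\mu,$$ $$\int_D(f_0g_2-f_3g_1+f_1g_3-f_2g_0)w\,d\mu,\ \int_D(f_0g_3-f_1g_2+f_2g_1-f_3g_0)w\,d\mu\Big),$$ i.e. the components of $\int_D\bar fg\,w\,d\mu$; the same formula is used for any four-tuples that are square-integrable with respect to $w\,d\mu$. *)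

theory Defs
  imports "HOL-Analysis.Analysis"
begin

section \<open>Quaternions\<close>

text \<open>\<open>Quat a b c d\<close> stands for \<open>a + b e\<^sub>1 + c e\<^sub>2 + d e\<^sub>3\<close>.\<close>

datatype quat = Quat (qRe: real) (qIm1: real) (qIm2: real) (qIm3: real)

lemma quat_eq_iff:
  "x = y \<longleftrightarrow> qRe x = qRe y \<and> qIm1 x = qIm1 y \<and> qIm2 x = qIm2 y \<and> qIm3 x = qIm3 y"
  by (auto intro: quat.expand)

instantiation quat :: real_normed_div_algebra
begin

definition "0 = Quat 0 0 0 0"
definition "1 = Quat 1 0 0 0"
definition "x + y = Quat (qRe x + qRe y) (qIm1 x + qIm1 y) (qIm2 x + qIm2 y) (qIm3 x + qIm3 y)"
definition "x - y = Quat (qRe x - qRe y) (qIm1 x - qIm1 y) (qIm2 x - qIm2 y) (qIm3 x - qIm3 y)"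
definition "- x = Quat (- qRe x) (- qIm1 x) (- qIm2 x) (- qIm3 x)"
definition "x * y = Quat
  (qRe x * qRe y - qIm1 x * qIm1 y - qIm2 x * qIm2 y - qIm3 x * qIm3 y)
  (qRe x * qIm1 y + qIm1 x * qRe y + qIm2 x * qIm3 y - qIm3 x * qIm2 y)
  (qRe x * qIm2 y - qIm1 x * qIm3 y + qIm2 x * qRe y + qIm3 x * qIm1 y)
  (qRe x * qIm3 y + qIm1 x * qIm2 y - qIm2 x * qIm1 y + qIm3 x * qRe y)"
definition "t *\<^sub>R x = Quat (t * qRe x) (t * qIm1 x) (t * qIm2 x) (t * qIm3 x)"
definition "norm x = sqrt ((qRe x)\<^sup>2 + (qIm1 x)\<^sup>2 + (qIm2 x)\<^sup>2 + (qIm3 x)\<^sup>2)"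
definition "inverse x =
  (let n = (qRe x)\<^sup>2 + (qIm1 x)\<^sup>2 + (qIm2 x)\<^sup>2 + (qIm3 x)\<^sup>2
   in Quat (qRe x / n) (- qIm1 x / n) (- qIm2 x / n) (- qIm3 x / n))"
definition "x div y = x * inverse y" for x y :: quat
definition "sgn x = inverse (norm x) *\<^sub>R x" for x :: quat
definition "dist x y = norm (x - y)" for x y :: quat
definition [code del]:
  "(uniformity :: (quat \<times> quat) filter) = (INF e\<in>{0 <..}. principal {(x, y). dist x y < e})"
definition [code del]:
  "open (U :: quat set) \<longleftrightarrow> (\<forall>x\<in>U. eventually (\<lambda>(x', y). x' = x \<longrightarrow> y \<in> U) uniformity)"

lemmas quat_arith_defs =
  zero_quat_def one_quat_def plus_quat_def minus_quat_def uminus_quat_def times_quat_def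
  scaleR_quat_def

lemma quat_sumsq_eq_0:
  "(qRe x)\<^sup>2 + (qIm1 x)\<^sup>2 + (qIm2 x)\<^sup>2 + (qIm3 x)\<^sup>2 = 0 \<longleftrightarrow> x = 0"
  by (simp add: quat_eq_iff zero_quat_def add_nonneg_eq_0_iff)

lemma quat_inverse_left:
  fixes x :: quat assumes "x \<noteq> 0" shows "inverse x * x = 1" and "x * inverse x = 1"
proof -
  define n where "n = (qRe x)\<^sup>2 + (qIm1 x)\<^sup>2 + (qIm2 x)\<^sup>2 + (qIm3 x)\<^sup>2"
  have n: "n \<noteq> 0" using assms quat_sumsq_eq_0 unfolding n_def by blast
  have i: "inverse x = Quat (qRe x / n) (- qIm1 x / n) (- qIm2 x / n) (- qIm3 x / n)"
    by (simp add: inverse_quat_def n_def Let_def)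
  have k: "qRe x * qRe x / n + qIm1 x * qIm1 x / n + qIm2 x * qIm2 x / n + qIm3 x * qIm3 x / n = 1"
    using n by (simp add: n_def power2_eq_square flip: add_divide_distrib)
  show "inverse x * x = 1" "x * inverse x = 1"
    using k by (simp_all add: i times_quat_def one_quat_def mult.commute)
qed

lemma norm_quat_eq: "norm x = norm (qRe x, qIm1 x, qIm2 x, qIm3 x)"
  by (simp add: norm_quat_def norm_Pair add.assoc)

instance
proof
  fix x y z :: quat and s t :: real
  show "x + y + z = x + (y + z)" "x + y = y + x" "0 + x = x" "- x + x = 0" "x - y = x + - y"
    "t *\<^sub>R (x + y) = t *\<^sub>R x + t *\<^sub>R y" "(s + t) *\<^sub>R x = s *\<^sub>R x + t *\<^sub>R x"
    "s *\<^sub>R t *\<^sub>R x = (s * t) *\<^sub>R x" "1 *\<^sub>R x = x"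
    "x * y * z = x * (y * z)" "(x + y) * z = x * z + y * z" "x * (y + z) = x * y + x * z"
    "1 * x = x" "x * 1 = x" "t *\<^sub>R x * y = t *\<^sub>R (x * y)" "x * t *\<^sub>R y = t *\<^sub>R (x * y)"
    "(0 :: quat) \<noteq> 1"
    by (simp_all add: quat_arith_defs quat_eq_iff algebra_simps)
  show "x \<noteq> 0 \<Longrightarrow> inverse x * x = 1" "x \<noteq> 0 \<Longrightarrow> x * inverse x = 1"
    by (simp_all add: quat_inverse_left)
  show "inverse (0::quat) = 0" by (simp add: inverse_quat_def zero_quat_def)
  show "(norm x = 0) = (x = 0)"
    by (simp only: norm_quat_def real_sqrt_eq_zero_cancel_iff quat_sumsq_eq_0)
  show "norm (x + y) \<le> norm x + norm y"
    using norm_triangle_ineq[of "(qRe x, qIm1 x, qIm2 x, qIm3 x)" "(qRe y, qIm1 y, qIm2 y, qIm3 y)"]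
    by (simp add: norm_quat_eq plus_quat_def)
  show "norm (t *\<^sub>R x) = \<bar>t\<bar> * norm x"
    using norm_scaleR[of t "(qRe x, qIm1 x, qIm2 x, qIm3 x)"]
    by (simp add: norm_quat_eq scaleR_quat_def)
  show "norm (x * y) = norm x * norm y"
    by (simp add: norm_quat_def times_quat_def real_sqrt_mult [symmetric]
        power2_eq_square algebra_simps)
qed (rule divide_quat_def sgn_quat_def dist_quat_def open_quat_def uniformity_quat_def)+

end

definition qcnj :: "quat \<Rightarrow> quat"
  where "qcnj x = Quat (qRe x) (- qIm1 x) (- qIm2 x) (- qIm3 x)"

lemma quat_units:
  defines "e1 \<equiv> Quat 0 1 0 0" and "e2 \<equiv> Quat 0 0 1 0" and "e3 \<equiv> Quat 0 0 0 1"
  shows "e1 * e2 = e3" "e2 * e3 = e1" "e3 * e1 = e2" "e1 * e1 = - 1" "e2 * e2 = - 1" "e3 * e3 = - 1"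
  by (simp_all add: e1_def e2_def e3_def quat_arith_defs)


section \<open>Points of the four-dimensional space\<close>

text \<open>
  Coordinates are written \<open>x $ 0, \<dots>, x $ 3\<close>; the index type \<open>4\<close> consists of the residues modulo 4,
  so these are four distinct indices and exhaust the type.
\<close>

definition tup4 :: "real \<Rightarrow> real \<Rightarrow> real \<Rightarrow> real \<Rightarrow> real^4"
  where "tup4 u0 u1 u2 u3 = (\<chi> k. if k = 0 then u0 else if k = 1 then u1 else if k = 2 then u2 else u3)"

text \<open>The identification through the structural set \<open>\<psi> = {1, e\<^sub>1, -e\<^sub>2, e\<^sub>3}\<close>, and its inverse.\<close>

definition psi :: "real^4 \<Rightarrow> quat"
  where "psi x = Quat (x $ 0) (x $ 1) (- (x $ 2)) (x $ 3)"

definition psi_coords :: "quat \<Rightarrow> real^4"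
  where "psi_coords u = tup4 (qRe u) (qIm1 u) (- qIm2 u) (qIm3 u)"

lemma tup4_nth [simp]:
  "tup4 u0 u1 u2 u3 $ 0 = u0" "tup4 u0 u1 u2 u3 $ 1 = u1"
  "tup4 u0 u1 u2 u3 $ 2 = u2" "tup4 u0 u1 u2 u3 $ 3 = u3"
  by (simp_all add: tup4_def)

lemma index4_cases: "k = 0 \<or> k = 1 \<or> k = 2 \<or> k = 3" for k :: 4
  using exhaust_4[of k] by auto

lemma psi_psi_coords [simp]: "psi (psi_coords u) = u"
  by (simp add: psi_def psi_coords_def quat_eq_iff)

lemma psi_coords_psi [simp]: "psi_coords (psi x) = x"
  by (simp add: psi_def psi_coords_def tup4_def vec_eq_iff) (metis index4_cases)

definition is_domain :: "(real^4) set \<Rightarrow> bool"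
  where "is_domain D \<longleftrightarrow> open D \<and> connected D \<and> D \<noteq> {}"


section \<open>Cimmino systems\<close>

text \<open>
  A four-tuple \<open>(f\<^sub>0, f\<^sub>1, f\<^sub>2, f\<^sub>3)\<close> of real functions is a single function \<open>f\<close> into \<open>real^4\<close>, with
  \<open>f\<^sub>k y = f y $ k\<close>. These are the coordinates with respect to \<open>1, e\<^sub>1, e\<^sub>2, e\<^sub>3\<close>, whereas points and
  the coefficient of the system are read through \<open>psi\<close>.
\<close>

definition partial :: "4 \<Rightarrow> (real^4 \<Rightarrow> real) \<Rightarrow> real^4 \<Rightarrow> real"
  where "partial j g x = frechet_derivative g (at x) (axis j 1)"

definition C1_on :: "(real^4 \<Rightarrow> real) \<Rightarrow> (real^4) set \<Rightarrow> bool"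
  where "C1_on g D \<longleftrightarrow> (\<forall>x\<in>D. g differentiable (at x)) \<and> (\<forall>j. continuous_on D (partial j g))"

definition cimmino_system :: "(real^4) set \<Rightarrow> (real^4 \<Rightarrow> real^4) \<Rightarrow> (real^4 \<Rightarrow> real^4) \<Rightarrow> bool"
  where "cimmino_system D \<delta> f \<longleftrightarrow>
    (\<forall>x\<in>D. let p = (\<lambda>k j. partial j (\<lambda>y. f y $ k) x); F = (\<lambda>k. f x $ k); dl = (\<lambda>n. \<delta> x $ n) in
       p 0 0 + p 2 2 - p 1 1 - p 3 3 = - (dl 0 * F 0 + dl 2 * F 2 - dl 1 * F 1 - dl 3 * F 3) \<and>
       p 0 1 + p 1 0 - p 2 3 - p 3 2 = - (dl 1 * F 0 + dl 0 * F 1 - dl 3 * F 2 - dl 2 * F 3) \<and>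
       p 0 2 + p 3 1 - p 1 3 - p 2 0 = - (dl 2 * F 0 + dl 1 * F 3 - dl 3 * F 1 - dl 0 * F 2) \<and>
       p 0 3 + p 1 2 + p 2 1 + p 3 0 = - (dl 3 * F 0 + dl 2 * F 1 + dl 1 * F 2 + dl 0 * F 3))"


section \<open>The function spaces\<close>

text \<open>
  A function on \<open>D\<close> is represented by its extension by zero to the whole space, so that equality of
  elements of the space is equality on \<open>D\<close>.
\<close>

definition cimmino_bergman ::
  "(real^4) set \<Rightarrow> (real^4 \<Rightarrow> real^4) \<Rightarrow> (real^4 \<Rightarrow> real) \<Rightarrow> (real^4 \<Rightarrow> real^4) set"
  where "cimmino_bergman D \<delta> w = {f.
    (\<forall>x. x \<notin> D \<longrightarrow> f x = 0) \<and>
    (\<forall>k. C1_on (\<lambda>y. f y $ k) D) \<and>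
    cimmino_system D \<delta> f \<and>
    (\<forall>k. integrable (lebesgue_on D) (\<lambda>y. \<bar>f y $ k\<bar>\<^sup>2 * w y))}"

definition wnorm :: "(real^4) set \<Rightarrow> (real^4 \<Rightarrow> real) \<Rightarrow> (real^4 \<Rightarrow> real^4) \<Rightarrow> real"
  where "wnorm D w f =
    sqrt (\<integral>y. ((f y $ 0)\<^sup>2 + (f y $ 1)\<^sup>2 + (f y $ 2)\<^sup>2 + (f y $ 3)\<^sup>2) * w y \<partial>lebesgue_on D)"

definition wform ::
  "(real^4) set \<Rightarrow> (real^4 \<Rightarrow> real) \<Rightarrow> (real^4 \<Rightarrow> real^4) \<Rightarrow> (real^4 \<Rightarrow> real^4) \<Rightarrow> real^4"
  where "wform D w f g = tup4
    (\<integral>y. (f y $ 0 * g y $ 0 + f y $ 1 * g y $ 1 + f y $ 2 * g y $ 2 + f y $ 3 * g y $ 3) * w y \<partial>lebesgue_on D)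
    (\<integral>y. (f y $ 0 * g y $ 1 - f y $ 1 * g y $ 0 - f y $ 2 * g y $ 3 + f y $ 3 * g y $ 2) * w y \<partial>lebesgue_on D)
    (\<integral>y. (f y $ 0 * g y $ 2 - f y $ 3 * g y $ 1 + f y $ 1 * g y $ 3 - f y $ 2 * g y $ 0) * w y \<partial>lebesgue_on D)
    (\<integral>y. (f y $ 0 * g y $ 3 - f y $ 1 * g y $ 2 + f y $ 2 * g y $ 1 - f y $ 3 * g y $ 0) * w y \<partial>lebesgue_on D)"

definition wL2 :: "(real^4) set \<Rightarrow> (real^4 \<Rightarrow> real) \<Rightarrow> (real^4 \<Rightarrow> real^4) set"
  where "wL2 D w = {g. \<forall>k.
    (\<lambda>y. g y $ k) \<in> borel_measurable (lebesgue_on D) \<and>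
    integrable (lebesgue_on D) (\<lambda>y. \<bar>g y $ k\<bar>\<^sup>2 * w y)}"

definition real_banach_space :: "('a \<Rightarrow> 'b::real_vector) set \<Rightarrow> (('a \<Rightarrow> 'b) \<Rightarrow> real) \<Rightarrow> bool"
  where "real_banach_space X N \<longleftrightarrow>
    (\<lambda>x. 0) \<in> X \<and>
    (\<forall>f\<in>X. \<forall>g\<in>X. (\<lambda>x. f x + g x) \<in> X) \<and>
    (\<forall>t::real. \<forall>f\<in>X. (\<lambda>x. t *\<^sub>R f x) \<in> X) \<and>
    (\<forall>f\<in>X. 0 \<le> N f \<and> (N f = 0 \<longleftrightarrow> f = (\<lambda>x. 0))) \<and>
    (\<forall>t::real. \<forall>f\<in>X. N (\<lambda>x. t *\<^sub>R f x) = \<bar>t\<bar> * N f) \<and>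
    (\<forall>f\<in>X. \<forall>g\<in>X. N (\<lambda>x. f x + g x) \<le> N f + N g) \<and>
    (\<forall>u::nat \<Rightarrow> 'a \<Rightarrow> 'b.
       (\<forall>n. u n \<in> X) \<and> (\<forall>e>0. \<exists>M. \<forall>m\<ge>M. \<forall>n\<ge>M. N (\<lambda>x. u m x - u n x) < e)
       \<longrightarrow> (\<exists>f\<in>X. (\<lambda>n. N (\<lambda>x. u n x - f x)) \<longlonglongrightarrow> 0))"

text \<open>
  Here \<open>B\<^sub>k(x, y) = B x y $ k\<close>, and \<open>kernel_tuple B x\<close> is
  \<open>(B\<^sub>0(x,\<cdot>), -B\<^sub>1(x,\<cdot>), -B\<^sub>2(x,\<cdot>), -B\<^sub>3(x,\<cdot>))\<close>; only the values of \<open>B\<close> on \<open>D \<times> D\<close> matter.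
\<close>

definition kernel_tuple :: "(real^4 \<Rightarrow> real^4 \<Rightarrow> real^4) \<Rightarrow> real^4 \<Rightarrow> real^4 \<Rightarrow> real^4"
  where "kernel_tuple B x = (\<lambda>y. tup4 (B x y $ 0) (- (B x y $ 1)) (- (B x y $ 2)) (- (B x y $ 3)))"

definition reproducing_with_projection ::
  "(real^4) set \<Rightarrow> (real^4 \<Rightarrow> real) \<Rightarrow> (real^4 \<Rightarrow> real^4) set \<Rightarrow> bool"
  where "reproducing_with_projection D w X \<longleftrightarrow>
    (\<exists>B. (\<forall>x\<in>D. kernel_tuple B x \<in> X \<and> (\<forall>f\<in>X. wform D w (kernel_tuple B x) f = f x)) \<and>
         (\<forall>g\<in>wL2 D w. (\<lambda>x. if x \<in> D then wform D w (kernel_tuple B x) g else 0) \<in> X))"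


section \<open>Moebius data\<close>

definition quat_moebius :: "quat \<Rightarrow> quat \<Rightarrow> quat \<Rightarrow> quat \<Rightarrow> real^4 \<Rightarrow> real^4"
  where "quat_moebius a b c d x = psi_coords ((a * psi x + b) * inverse (c * psi x + d))"

definition moebius_V :: "quat \<Rightarrow> quat \<Rightarrow> quat \<Rightarrow> quat \<Rightarrow> quat"
  where "moebius_V a b c d = b - a * inverse c * d"

definition delta_T :: "quat \<Rightarrow> quat \<Rightarrow> quat \<Rightarrow> quat \<Rightarrow> real^4 \<Rightarrow> real^4 \<Rightarrow> real^4"
  where "delta_T a b c d r y = psi_coords
    (if c = 0 then inverse (qcnj a) * psi r * qcnj d
     else let Y = psi y - a * inverse c; V = moebius_V a b c d in
       - ((Y * c * psi r * qcnj V * Y) /\<^sub>R ((norm c)\<^sup>2 * (norm Y) ^ 4)))"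

definition rho_T :: "quat \<Rightarrow> quat \<Rightarrow> quat \<Rightarrow> quat \<Rightarrow> real^4 \<Rightarrow> real"
  where "rho_T a b c d x =
    (if c = 0 then 1
     else let V = moebius_V a b c d in
       inverse ((norm (c * psi x * inverse V + d * inverse V))\<^sup>2))"

definition gamma_T ::
  "(real^4) set \<Rightarrow> quat \<Rightarrow> quat \<Rightarrow> quat \<Rightarrow> quat \<Rightarrow> real^4 \<Rightarrow> real^4 \<Rightarrow> real^4 \<Rightarrow> real"
  where "gamma_T \<Xi> a b c d r q y = exp (2 * ((r - q) \<bullet> the_inv_into \<Xi> (quat_moebius a b c d) y))"

definition lambda_weight :: "real^4 \<Rightarrow> real^4 \<Rightarrow> real"
  where "lambda_weight q x = exp (2 * (q \<bullet> x))"

end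

theory Submission
  imports Defs
begin

text \<open>
  All three coefficients are gradients of real functions: the constant \<open>q\<close> of \<open>\<langle>q, x\<rangle>\<close>, and
  \<open>\<delta>\<^sub>T\<^sub>,\<^sub>r\<close> of \<open>\<langle>r, T\<^sup>-\<^sup>1 y\<rangle>\<close>. If \<open>\<delta> = grad \<phi>\<close>, then \<open>D[e\<^sup>\<phi> f] = e\<^sup>\<phi> (D[f] + \<delta> f)\<close>, where \<open>D\<close> is the
  left Cauchy-Riemann operator of the structural set, so \<open>f\<close> solves the inhomogeneous system exactly
  when \<open>g = e\<^sup>\<phi> f\<close> is monogenic, that is, \<open>D[g] = 0\<close>. The theorem is therefore an instance of one
  statement about a gradient coefficient and an arbitrary positive continuous weight, which is proved
  in the locale \<open>gradient_cimmino\<close>; the Moebius map enters only through the potential.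

  The analytic input is an interior estimate: near each point, the values and the first partial
  derivatives of a monogenic \<open>g\<close> are bounded by the integral of \<open>\<bar>g\<bar>\<close> over a neighbourhood
  (\<open>monogenic_local_estimate\<close>), hence by the weighted norm of \<open>f\<close> (\<open>local_bound\<close>). It follows from the
  mean value property \<open>monogenic_mean_value\<close> with respect to a radial bump function. As \<open>g\<close> is only
  assumed to be \<open>C\<^sup>1\<close>, its harmonicity is not available at the outset; instead the first-order system is combined with
  the fact that rotations leave the bump function unchanged.

  Completeness: a Cauchy sequence converges locally uniformly together with its first derivatives, so
  its limit is a \<open>C\<^sup>1\<close> solution, and Fatou's lemma turns the pointwise limit into a limit in norm.

  Kernels: solutions may be multiplied by constant quaternions from the right, and the components of
  \<open>\<langle>f, g\<rangle>\<close> are the real inner products of \<open>f e\<^sub>i\<close> with \<open>g\<close>. Hence the Riesz representation of the single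
  real functional \<open>f \<mapsto> f\<^sub>0(x)\<close> already reproduces all four components of \<open>f(x)\<close>. For
  square-integrable \<open>g\<close>, the functional \<open>\<langle>g, \<cdot>\<rangle>\<close> is represented by some \<open>p\<close> in the space, the orthogonal
  projection of \<open>g\<close>, and pairing \<open>g\<close> with the kernel gives the values of \<open>p\<close>.
\<close>


section \<open>Integrals of compactly supported functions\<close>

lemma integral_compact_support:
  fixes f :: "'a::euclidean_space \<Rightarrow> real"
  assumes "continuous_on UNIV f" and supp: "\<And>z. r \<le> norm z \<Longrightarrow> f z = 0"
  shows "f integrable_on UNIV"
    and "cball 0 r \<subseteq> cbox p q \<Longrightarrow> (f has_integral integral UNIV f) (cbox p q)"
proof -
  have int: "f integrable_on cbox p q" for p q
    by (rule integrable_continuous) (use assms(1) continuous_on_subset in blast)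
  have *: "(f has_integral integral (cbox p q) f) UNIV" if "cball 0 r \<subseteq> cbox p q" for p q
    by (rule has_integral_on_superset[OF integrable_integral[OF int]])
       (use that supp in \<open>force simp: subset_iff not_le\<close>)+
  obtain a where "cball (0::'a) r \<subseteq> cbox (- a) a"
    using bounded_subset_cbox_symmetric bounded_cball by blast
  from *[OF this] show "f integrable_on UNIV" by blast
  show "(f has_integral integral UNIV f) (cbox p q)" if "cball 0 r \<subseteq> cbox p q"
    using *[OF that] int by (metis integrable_integral integral_unique)
qed

lemma integral_UNIV_translate:
  fixes f :: "'a::euclidean_space \<Rightarrow> real"
  assumes "continuous_on UNIV f" and supp: "\<And>z. r \<le> norm z \<Longrightarrow> f z = 0"
  shows "integral UNIV (\<lambda>z. f (z + c)) = integral UNIV f"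
proof -
  obtain a where a: "cball (0::'a) r \<subseteq> cbox (- a) a"
    using bounded_subset_cbox_symmetric bounded_cball by blast
  have "((\<lambda>z. f (z + c)) has_integral integral UNIV f) (cbox (- a - c) (a - c))"
    by (intro has_integral_shift_cbox integral_compact_support(2)[OF assms a])
  then have "((\<lambda>z. f (z + c)) has_integral integral UNIV f) UNIV"
  proof (rule has_integral_on_superset)
    fix z assume "z \<notin> cbox (- a - c) (a - c)"
    then have "z + c \<notin> cbox (- a) a"
      by (auto simp: mem_box algebra_simps)
    then show "f (z + c) = 0" using a supp[of "z + c"] by (force simp: subset_iff)
  qed auto
  then show ?thesis by (rule integral_unique)
qed

text \<open>
  By translation invariance, the integral of \<open>F (z + s v)\<close> over \<open>z\<close> does not depend on \<open>s\<close>;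
  differentiating it under the integral sign at \<open>s = 0\<close> gives the claim.
\<close>

lemma integral_directional_derivative_eq_0:
  fixes F F' :: "'a::euclidean_space \<Rightarrow> real"
  assumes der: "\<And>z. ((\<lambda>s. F (z + s *\<^sub>R v)) has_real_derivative F' z) (at 0)"
    and cF: "continuous_on UNIV F" and cF': "continuous_on UNIV F'"
    and supp: "\<And>z. r \<le> norm z \<Longrightarrow> F z = 0"
  shows "integral UNIV F' = 0"
proof -
  have der_s: "((\<lambda>s. F (z + s *\<^sub>R v)) has_real_derivative F' (z + s *\<^sub>R v)) (at s)" for z s
    using DERIV_shift[of "\<lambda>s. F (z + s *\<^sub>R v)" "F' (z + s *\<^sub>R v)" 0 s] der[of "z + s *\<^sub>R v"]
    by (simp add: algebra_simps)
  have far: "r \<le> norm (z + s *\<^sub>R v)" if "r + norm v + 1 \<le> norm z" "\<bar>s\<bar> \<le> 1" for z s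
  proof -
    have "norm (s *\<^sub>R v) \<le> norm v" using that(2) by (simp add: mult_left_le_one_le)
    then show ?thesis using norm_diff_ineq[of z "s *\<^sub>R v"] that(1) by linarith
  qed
  have supp': "F' z = 0" if "r + norm v + 1 \<le> norm z" for z
  proof -
    have "((\<lambda>s::real. 0::real) has_real_derivative F' z) (at 0)"
      by (rule has_field_derivative_transform_within_open[OF der, of "{-1<..<1}"])
         (use supp far that in auto)
    then show ?thesis by (metis DERIV_const DERIV_unique)
  qed
  obtain a where a: "cball (0::'a) (r + norm v + 1) \<subseteq> cbox (- a) a"
    using bounded_subset_cbox_symmetric bounded_cball by blast
  define \<Psi> where "\<Psi> s = integral (cbox (-a) a) (\<lambda>z. F (z + s *\<^sub>R v))" for s
  have "\<Psi> s = integral UNIV F" if "s \<in> {-1<..<1}" for s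
  proof -
    have "((\<lambda>z. F (z + s *\<^sub>R v)) has_integral integral UNIV (\<lambda>z. F (z + s *\<^sub>R v))) (cbox (-a) a)"
    proof (rule integral_compact_support(2)[OF _ _ a])
      show "continuous_on UNIV (\<lambda>z. F (z + s *\<^sub>R v))"
        by (rule continuous_on_compose2[OF cF]) (auto intro!: continuous_intros)
      show "F (z + s *\<^sub>R v) = 0" if "r + norm v + 1 \<le> norm z" for z
        using supp far[OF that] \<open>s \<in> _\<close> by auto
    qed
    then have "\<Psi> s = integral UNIV (\<lambda>z. F (z + s *\<^sub>R v))"
      unfolding \<Psi>_def by (rule integral_unique)
    also have "\<dots> = integral UNIV F" by (rule integral_UNIV_translate[OF cF supp])
    finally show ?thesis .
  qed
  then have "(\<Psi> has_real_derivative 0) (at 0)"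
    using has_field_derivative_transform_within_open[OF DERIV_const open_greaterThanLessThan, of 0 "-1" 1 _ \<Psi>]
    by simp
  moreover have "(\<Psi> has_real_derivative integral (cbox (-a) a) (\<lambda>z. F' (z + 0 *\<^sub>R v))) (at 0 within UNIV)"
    unfolding \<Psi>_def
  proof (rule leibniz_rule_field_derivative)
    show "(\<lambda>z. F (z + s *\<^sub>R v)) integrable_on cbox (- a) a" for s
      by (intro integrable_continuous continuous_on_compose2[OF cF]) (auto intro!: continuous_intros)
    show "continuous_on (UNIV \<times> cbox (- a) a) (\<lambda>(s, z). F' (z + s *\<^sub>R v))"
      unfolding split_beta by (intro continuous_on_compose2[OF cF']) (auto intro!: continuous_intros)
  qed (use der_s in auto)
  ultimately have "integral (cbox (-a) a) F' = 0"
    using DERIV_unique by force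
  moreover have "integral (cbox (-a) a) F' = integral UNIV F'"
    by (rule integral_unique[OF integral_compact_support(2)[OF cF' supp' a]])
  ultimately show ?thesis by simp
qed

section \<open>Gradients on the four-dimensional space\<close>

lemma sum_index4: "(\<Sum>k\<in>UNIV. f k) = f 0 + f 1 + f 2 + f (3::4)"
proof -
  have "f 4 = f 0" by (rule arg_cong) simp
  then show ?thesis using sum_4[of f] by (simp add: ac_simps)
qed

lemma inner_real4: "u \<bullet> v = u $ 0 * v $ 0 + u $ 1 * v $ 1 + u $ 2 * v $ 2 + u $ 3 * v $ 3"
  for u v :: "real^4"
  by (simp add: inner_vec_def sum_index4)

lemma all_index4: "(\<forall>k::4. P k) \<longleftrightarrow> P 0 \<and> P 1 \<and> P 2 \<and> P 3"
  by (metis index4_cases)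

definition grad :: "(real^4 \<Rightarrow> real) \<Rightarrow> real^4 \<Rightarrow> real^4"
  where "grad g x = (\<chi> j. partial j g x)"

lemma has_derivative_grad:
  assumes "g differentiable (at x)"
  shows "(g has_derivative (\<lambda>h. grad g x \<bullet> h)) (at x)"
proof -
  have d: "(g has_derivative frechet_derivative g (at x)) (at x)"
    using assms frechet_derivative_works by blast
  then interpret linear "frechet_derivative g (at x)" by (rule has_derivative_linear)
  have "frechet_derivative g (at x) h = grad g x \<bullet> h" for h
  proof -
    have "frechet_derivative g (at x) h = frechet_derivative g (at x) (\<Sum>j\<in>UNIV. h $ j *\<^sub>R axis j 1)"
      using basis_expansion[of h] by (simp add: scalar_mult_eq_scaleR)
    also have "\<dots> = (\<Sum>j\<in>UNIV. h $ j * partial j g x)"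
      by (simp add: sum scale partial_def)
    finally show ?thesis by (simp add: grad_def inner_vec_def mult.commute)
  qed
  then have "frechet_derivative g (at x) = (\<lambda>h. grad g x \<bullet> h)" by (rule ext)
  with d show ?thesis by simp
qed

lemma has_derivative_partial:
  assumes "(g has_derivative (\<lambda>h. v \<bullet> h)) (at x)"
  shows "g differentiable (at x)" and "partial j g x = v $ j" and "grad g x = v"
proof -
  show "g differentiable (at x)" using assms by (rule differentiableI)
  have "partial j g x = v $ j" for j
    unfolding partial_def frechet_derivative_at[OF assms, symmetric]
    by (simp add: inner_axis)
  then show "partial j g x = v $ j" "grad g x = v" by (simp_all add: grad_def vec_eq_iff)
qed

lemma C1_on_grad:
  "C1_on g D \<longleftrightarrow> (\<forall>x\<in>D. g differentiable (at x)) \<and> continuous_on D (grad g)"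
  by (auto simp: C1_on_def grad_def[abs_def] intro!: continuous_intros
      dest: continuous_on_component)

lemma C1_on_imp_continuous_on: "C1_on g D \<Longrightarrow> continuous_on D g"
  unfolding C1_on_def
  by (meson continuous_at_imp_continuous_on differentiable_imp_continuous_within)

section \<open>A radial bump function\<close>

text \<open>
  Any radial \<open>C\<^sup>1\<close> bump function would do. The square of \<open>(R\<^sup>2 - |z|\<^sup>2)\<^sup>+\<close> is \<open>C\<^sup>1\<close> and has the explicit gradient
  \<open>- 4 (R\<^sup>2 - |z|\<^sup>2)\<^sup>+ z\<close>, which is parallel to \<open>z\<close>.
\<close>

definition trunc :: "real \<Rightarrow> real^4 \<Rightarrow> real"
  where "trunc R z = max 0 (R\<^sup>2 - z \<bullet> z)"

definition bump :: "real \<Rightarrow> real^4 \<Rightarrow> real"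
  where "bump R z = (trunc R z)\<^sup>2"

lemma trunc_nonneg: "0 \<le> trunc R z" and trunc_le: "trunc R z \<le> R\<^sup>2"
  by (simp_all add: trunc_def)

lemma trunc_eq_0: "0 \<le> R \<Longrightarrow> R \<le> norm z \<Longrightarrow> trunc R z = 0"
  by (simp add: trunc_def dot_square_norm max_def)

lemma bump_eq_0: "0 \<le> R \<Longrightarrow> R \<le> norm z \<Longrightarrow> bump R z = 0"
  by (simp add: bump_def trunc_eq_0)

lemma continuous_on_trunc [continuous_intros]: "continuous_on S (trunc R)"
  unfolding trunc_def[abs_def] by (intro continuous_intros)

lemma continuous_on_bump [continuous_intros]: "continuous_on S (bump R)"
  unfolding bump_def[abs_def] by (intro continuous_intros)

lemma bump_nonneg: "0 \<le> bump R z"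
  by (simp add: bump_def)

lemma bump_le: "bump R z \<le> R ^ 4"
proof -
  have "trunc R z \<le> R\<^sup>2" "0 \<le> trunc R z" by (simp_all add: trunc_def)
  then have "(trunc R z)\<^sup>2 \<le> (R\<^sup>2)\<^sup>2" by (intro power_mono) auto
  then show ?thesis by (simp add: bump_def)
qed

lemma bump_lipschitz:
  assumes "norm z \<le> S" "norm z' \<le> S"
  shows "\<bar>bump R z - bump R z'\<bar> \<le> 4 * R\<^sup>2 * S * norm (z - z')"
proof -
  have S: "0 \<le> S" using assms(1) norm_ge_zero order_trans by blast
  have "\<bar>bump R z - bump R z'\<bar> = \<bar>trunc R z - trunc R z'\<bar> * (trunc R z + trunc R z')"
  proof -
    have "bump R z - bump R z' = (trunc R z - trunc R z') * (trunc R z + trunc R z')"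
      by (simp add: bump_def power2_eq_square algebra_simps)
    moreover have "0 \<le> trunc R z + trunc R z'" by (simp add: trunc_def)
    ultimately show ?thesis by (simp add: abs_mult)
  qed
  also have "\<dots> \<le> (2 * S * norm (z - z')) * (2 * R\<^sup>2)"
  proof (rule mult_mono)
    have "\<bar>trunc R z - trunc R z'\<bar> \<le> \<bar>z \<bullet> z - z' \<bullet> z'\<bar>" by (simp add: trunc_def)
    also have "z \<bullet> z - z' \<bullet> z' = (z - z') \<bullet> (z + z')" by (simp add: algebra_simps inner_commute)
    also have "\<bar>\<dots>\<bar> \<le> norm (z - z') * norm (z + z')" by (rule Cauchy_Schwarz_ineq2)
    also have "\<dots> \<le> norm (z - z') * (2 * S)"
      using assms norm_triangle_ineq[of z z'] by (intro mult_left_mono) auto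
    finally show "\<bar>trunc R z - trunc R z'\<bar> \<le> 2 * S * norm (z - z')" by (simp add: mult_ac)
    show "trunc R z + trunc R z' \<le> 2 * R\<^sup>2" using trunc_le[of R z] trunc_le[of R z'] by simp
  qed (use S in \<open>auto intro: add_nonneg_nonneg trunc_nonneg\<close>)
  finally show ?thesis by (simp add: mult_ac)
qed

lemma DERIV_positive_part_squared: "((\<lambda>p. (max 0 p)\<^sup>2) has_real_derivative 2 * max 0 p) (at p)"
proof -
  consider "p < 0" | "p = 0" | "p > 0" by linarith
  then show ?thesis
  proof cases
    case 1
    have "((\<lambda>p::real. (max 0 p)\<^sup>2) has_real_derivative 0) (at p)"
      by (rule has_field_derivative_transform_within_open[of "\<lambda>_. 0" _ _ "{..<0}"]) (use 1 in auto)
    with 1 show ?thesis by simp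
  next
    case 3
    have "((\<lambda>p::real. (max 0 p)\<^sup>2) has_real_derivative 2 * p) (at p)"
      by (rule has_field_derivative_transform_within_open[of "\<lambda>p. p\<^sup>2" _ _ "{0<..}"])
         (use 3 in \<open>auto intro!: derivative_eq_intros\<close>)
    with 3 show ?thesis by simp
  next
    case 2
    have "((\<lambda>h::real. (max 0 h)\<^sup>2 / h) \<longlongrightarrow> 0) (at 0)"
    proof (rule Lim_null_comparison)
      have "\<bar>(max 0 h)\<^sup>2 / h\<bar> \<le> \<bar>h\<bar>" for h :: real
        by (cases "h \<le> 0") (auto simp: max_def power2_eq_square)
      then show "\<forall>\<^sub>F h in at 0. norm ((max 0 h)\<^sup>2 / h) \<le> \<bar>h\<bar>" for h :: real by simp
      show "((\<lambda>h::real. \<bar>h\<bar>) \<longlongrightarrow> 0) (at 0)" by (rule tendsto_eq_intros | simp)+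
    qed
    with 2 show ?thesis by (simp add: DERIV_def)
  qed
qed

lemma bump_line_derivative:
  "((\<lambda>s. bump R (z + s *\<^sub>R v)) has_real_derivative - 4 * (z \<bullet> v) * trunc R z) (at 0)"
proof -
  have "((\<lambda>s. R\<^sup>2 - (z + s *\<^sub>R v) \<bullet> (z + s *\<^sub>R v)) has_real_derivative - 2 * (z \<bullet> v)) (at 0)"
    unfolding has_field_derivative_def
    by (rule derivative_eq_intros refl)+ (auto simp: fun_eq_iff inner_commute algebra_simps)
  from DERIV_chain2[OF DERIV_positive_part_squared this]
  show ?thesis by (simp add: bump_def trunc_def mult_ac)
qed

lemma line_derivative:
  assumes "g differentiable (at z)"
  shows "((\<lambda>s. g (z + s *\<^sub>R v)) has_real_derivative grad g z \<bullet> v) (at 0)"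
proof -
  have "((\<lambda>s. z + s *\<^sub>R v) has_derivative (\<lambda>s. s *\<^sub>R v)) (at 0)"
    by (auto intro!: derivative_eq_intros)
  moreover have "(g has_derivative (\<lambda>h. grad g z \<bullet> h)) (at (z + 0 *\<^sub>R v))"
    using has_derivative_grad[OF assms] by simp
  ultimately have "((\<lambda>s. g (z + s *\<^sub>R v)) has_derivative (\<lambda>s. grad g z \<bullet> (s *\<^sub>R v))) (at 0)"
    by (rule has_derivative_compose)
  then show ?thesis by (simp add: has_field_derivative_def mult_commute_abs)
qed

text \<open>
  A product with a cutoff factor is continuous even where the other factor is not, provided that the
  cutoff vanishes there. This allows integrals over the whole space of functions that are only
  controlled on a ball.
\<close>

lemma continuous_on_cutoff:
  fixes p v n :: "'a::topological_space \<Rightarrow> real"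
  assumes "closed A" "continuous_on UNIV n" "continuous_on A p"
    and v: "continuous_on {x\<in>A. n x \<le> R} v"
    and p0: "\<And>x. R \<le> n x \<Longrightarrow> p x = 0"
  shows "continuous_on A (\<lambda>x. p x * v x)"
proof -
  let ?I = "{x\<in>A. n x \<le> R}" and ?O = "{x\<in>A. R \<le> n x}"
  have "continuous_on (?I \<union> ?O) (\<lambda>x. p x * v x)"
  proof (rule continuous_on_closed_Un)
    show "closed ?I" "closed ?O"
      using closed_Collect_le[OF assms(2) continuous_on_const, of R]
        closed_Collect_le[OF continuous_on_const assms(2), of R] assms(1)
      by (simp_all add: Collect_conj_eq closed_Int)
    show "continuous_on ?I (\<lambda>x. p x * v x)"
      by (intro continuous_on_mult v continuous_on_subset[OF assms(3)]) auto
    show "continuous_on ?O (\<lambda>x. p x * v x)"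
      by (rule continuous_on_eq[OF continuous_on_const[of _ 0]]) (use p0 in auto)
  qed
  moreover have "?I \<union> ?O = A" by auto
  ultimately show ?thesis by simp
qed

lemma bump_cutoff:
  assumes "continuous_on (cball 0 R) v" "0 \<le> R"
  shows "continuous_on UNIV (\<lambda>z. bump R z * v z)" and "(\<lambda>z. bump R z * v z) integrable_on UNIV"
proof -
  show c: "continuous_on UNIV (\<lambda>z. bump R z * v z)"
    by (rule continuous_on_cutoff[where n = norm and R = R])
       (use assms bump_eq_0 in \<open>auto intro!: continuous_intros simp: cball_def\<close>)
  show "(\<lambda>z. bump R z * v z) integrable_on UNIV"
    by (rule integral_compact_support(1)[OF c]) (use assms bump_eq_0 in auto)
qed

text \<open>
  The operator \<open>z\<^sub>j \<partial>\<^sub>k - z\<^sub>k \<partial>\<^sub>j\<close> generates rotations, and rotations preserve the bump function; so the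
  integral of its value on \<open>u\<close> against the bump function vanishes. Analytically, for \<open>j \<noteq> k\<close>: in the derivative
  \<open>\<partial>\<^sub>k (bump z\<^sub>j u)\<close>, which has integral zero, the term containing \<open>\<partial>\<^sub>k bump\<close> is
  \<open>- 4 trunc z\<^sub>j z\<^sub>k u\<close> and hence symmetric in \<open>j\<close> and \<open>k\<close>.
\<close>

lemma integral_bump_angular_symmetric:
  assumes u: "C1_on u D" and D: "open D" "cball 0 R \<subseteq> D" and R: "0 \<le> R"
  shows "integral UNIV (\<lambda>z. bump R z * (z $ j * partial k u z)) =
         integral UNIV (\<lambda>z. bump R z * (z $ k * partial j u z))"
proof (cases "j = k")
  case False
  have cu: "continuous_on (cball 0 R) u"
    using C1_on_imp_continuous_on[OF u] D(2) continuous_on_subset by blast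
  have cp: "continuous_on (cball 0 R) (partial l u)" for l
    using u D(2) continuous_on_subset unfolding C1_on_def by blast
  have key: "integral UNIV (\<lambda>z. bump R z * (z $ j * partial k u z)) =
      4 * integral UNIV (\<lambda>z. trunc R z * (z $ j * z $ k * u z))" if "j \<noteq> k" for j k
  proof -
    let ?F' = "\<lambda>z. bump R z * (z $ j * partial k u z) - 4 * (trunc R z * (z $ j * z $ k * u z))"
    have ct: "continuous_on UNIV (\<lambda>z. trunc R z * (z $ j * z $ k * u z))"
      by (rule continuous_on_cutoff[where n = norm and R = R])
         (use R trunc_eq_0 cu in \<open>auto intro!: continuous_intros simp: cball_def\<close>)
    have it: "(\<lambda>z. trunc R z * (z $ j * z $ k * u z)) integrable_on UNIV"
      by (rule integral_compact_support(1)[OF ct]) (use R trunc_eq_0 in auto)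
    have cb: "continuous_on (cball 0 R) (\<lambda>z. z $ j * partial k u z)"
      by (intro continuous_intros cp)
    have "integral UNIV ?F' = 0"
    proof (rule integral_directional_derivative_eq_0[where v = "axis k 1"])
      show "continuous_on UNIV (\<lambda>z. bump R z * (z $ j * u z))"
        by (intro bump_cutoff R continuous_intros cu)
      show "continuous_on UNIV ?F'"
        by (intro continuous_intros bump_cutoff(1)[OF cb R] ct)
      show "bump R z * (z $ j * u z) = 0" if "R \<le> norm z" for z
        using bump_eq_0[OF R that] by simp
      fix z
      show "((\<lambda>s. bump R (z + s *\<^sub>R axis k 1) * ((z + s *\<^sub>R axis k 1) $ j * u (z + s *\<^sub>R axis k 1)))
          has_real_derivative ?F' z) (at 0)"
      proof (cases "z \<in> D")
        case True
        then have "u differentiable (at z)" using u by (auto simp: C1_on_def)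
        note du = line_derivative[OF this, of "axis k 1"]
        have dz: "((\<lambda>s. (z + s *\<^sub>R axis k 1) $ j) has_real_derivative 0) (at 0)"
          using \<open>j \<noteq> k\<close> by (simp add: axis_def)
        show ?thesis
          by (rule DERIV_cong[OF DERIV_mult[OF bump_line_derivative DERIV_mult[OF dz du]]])
             (simp add: inner_axis grad_def algebra_simps)
      next
        case False
        have z: "R < norm z" using False D(2) by (force simp: subset_iff not_le)
        have "((\<lambda>s. bump R (z + s *\<^sub>R axis k 1) * ((z + s *\<^sub>R axis k 1) $ j * u (z + s *\<^sub>R axis k 1)))
          has_real_derivative 0) (at 0)"
        proof (rule has_field_derivative_transform_within_open[OF DERIV_const])
          show "open {s. R < norm (z + s *\<^sub>R axis k 1)}"
            by (intro open_Collect_less continuous_intros)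
          show "0 \<in> {s. R < norm (z + s *\<^sub>R axis k 1)}" using z by simp
        qed (use R bump_eq_0 in auto)
        then show ?thesis using z R by (simp add: bump_eq_0 trunc_eq_0)
      qed
    qed
    moreover have "integral UNIV ?F' = integral UNIV (\<lambda>z. bump R z * (z $ j * partial k u z))
        - 4 * integral UNIV (\<lambda>z. trunc R z * (z $ j * z $ k * u z))"
      by (subst Henstock_Kurzweil_Integration.integral_diff)
         (use bump_cutoff(2)[OF cb R] it integrable_on_cmult_left[OF it, of 4] in auto)
    ultimately show ?thesis by simp
  qed
  show ?thesis
    using key[OF False] key[of k j] False by (simp add: mult.commute[of "_ $ k"])
qed simp

section \<open>The mean value property of monogenic functions\<close>

lemma C1_on_rescale:
  assumes "C1_on g D" and E: "\<And>z. z \<in> E \<Longrightarrow> x + t *\<^sub>R z \<in> D"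
  shows "C1_on (\<lambda>z. g (x + t *\<^sub>R z)) E"
    and "z \<in> E \<Longrightarrow> partial k (\<lambda>z. g (x + t *\<^sub>R z)) z = t * partial k g (x + t *\<^sub>R z)"
proof -
  have d: "((\<lambda>z. g (x + t *\<^sub>R z)) has_derivative (\<lambda>h. (t *\<^sub>R grad g (x + t *\<^sub>R z)) \<bullet> h)) (at z)"
    if "z \<in> E" for z
  proof -
    have "((\<lambda>z. x + t *\<^sub>R z) has_derivative (\<lambda>h. t *\<^sub>R h)) (at z)"
      by (auto intro!: derivative_eq_intros)
    moreover have "(g has_derivative (\<lambda>h. grad g (x + t *\<^sub>R z) \<bullet> h)) (at (x + t *\<^sub>R z))"
      using assms(1) E[OF that] by (intro has_derivative_grad) (auto simp: C1_on_def)
    ultimately show ?thesis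
      using has_derivative_compose[of "\<lambda>z. x + t *\<^sub>R z" "\<lambda>h. t *\<^sub>R h" z UNIV g
          "\<lambda>h. grad g (x + t *\<^sub>R z) \<bullet> h"] by simp
  qed
  have "continuous_on E (\<lambda>z. t *\<^sub>R grad g (x + t *\<^sub>R z))"
    by (intro continuous_intros continuous_on_compose2[OF _ _ image_subsetI[OF E], of "grad g"])
       (use assms(1) in \<open>auto simp: C1_on_grad\<close>)
  then show "C1_on (\<lambda>z. g (x + t *\<^sub>R z)) E"
    unfolding C1_on_grad
    by (auto intro: has_derivative_partial(1)[OF d] continuous_on_eq
        simp: has_derivative_partial(3)[OF d])
  show "partial k (\<lambda>z. g (x + t *\<^sub>R z)) z = t * partial k g (x + t *\<^sub>R z)" if "z \<in> E"
    using has_derivative_partial(2)[OF d[OF that]] by (simp add: grad_def)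
qed

abbreviation monogenic_on :: "(real^4) set \<Rightarrow> (real^4 \<Rightarrow> real^4) \<Rightarrow> bool"
  where "monogenic_on D g \<equiv> (\<forall>k. C1_on (\<lambda>y. g y $ k) D) \<and> cimmino_system D (\<lambda>_. 0) g"

text \<open>
  This is the derivative in \<open>t\<close> of the mean of \<open>g (x + t z)\<close> over the bump function. Consider the moments
  \<open>A k j l\<close>, the integrals of \<open>\<partial>\<^sub>j g\<^sub>k (x + t z)\<close> against \<open>bump(z) z\<^sub>l\<close>, and the quaternions
  \<open>A\<^sub>j\<^sub>l = \<Sum>\<^sub>k A k j l e\<^sub>k\<close>. The system gives \<open>\<Sum>\<^sub>j \<psi>\<^sub>j A\<^sub>j\<^sub>l = 0\<close> for
  each \<open>l\<close>, and rotational invariance gives \<open>A\<^sub>j\<^sub>l = A\<^sub>l\<^sub>j\<close>. Multiplying by the conjugate of \<open>\<psi>\<^sub>l\<close> from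
  the left and summing over \<open>l\<close>, the off-diagonal terms cancel because
  \<open>cnj \<psi>\<^sub>l \<psi>\<^sub>j + cnj \<psi>\<^sub>j \<psi>\<^sub>l = 0\<close> for \<open>j \<noteq> l\<close>, and the trace \<open>\<Sum>\<^sub>j A\<^sub>j\<^sub>j = 0\<close> remains, which is the radial derivative.
\<close>

lemma monogenic_radial_integral_eq_0:
  assumes g: "monogenic_on D g" and D: "open D" "cball x R \<subseteq> D" and R: "0 \<le> R" and t: "0 < t" "t \<le> 1"
  shows "integral UNIV (\<lambda>z. bump R z * (grad (\<lambda>y. g y $ i) (x + t *\<^sub>R z) \<bullet> z)) = 0"
proof -
  define P where "P k j z = partial j (\<lambda>y. g y $ k) (x + t *\<^sub>R z)" for k j z
  define A where "A k j l = integral UNIV (\<lambda>z. bump R z * (z $ l * P k j z))" for k j l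
  have C1: "C1_on (\<lambda>y. g y $ k) D" for k using g by blast
  have inD: "x + t *\<^sub>R z \<in> D" if "z \<in> cball 0 R" for z
  proof -
    have "t * norm z \<le> norm z" using t by (simp add: mult_left_le_one_le)
    then show ?thesis using that t D(2) by (auto simp: subset_iff dist_norm)
  qed
  have cP: "continuous_on (cball 0 R) (P k j)" for k j
    unfolding P_def[abs_def]
    by (rule continuous_on_compose2[of D "partial j (\<lambda>y. g y $ k)"])
       (use C1 inD in \<open>auto simp: C1_on_def intro!: continuous_intros\<close>)
  have I: "((\<lambda>z. bump R z * (z $ l * P k j z)) has_integral A k j l) UNIV" for k j l
    unfolding A_def by (intro integrable_integral bump_cutoff(2) continuous_intros cP R)
  have sym: "A k j l = A k l j" for k j l
  proof -
    define E where "E = {z. x + t *\<^sub>R z \<in> D}"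
    have E: "open E"
      using open_vimage[OF D(1), of "\<lambda>z. x + t *\<^sub>R z"]
      by (simp add: E_def vimage_def continuous_intros)
    note C = C1_on_rescale[OF C1[of k], of E x t]
    have scaled: "integral UNIV (\<lambda>z. bump R z * (z $ l * partial j (\<lambda>z. g (x + t *\<^sub>R z) $ k) z)) = t * A k j l"
      for j l
    proof -
      have "(\<lambda>z. bump R z * (z $ l * partial j (\<lambda>z. g (x + t *\<^sub>R z) $ k) z)) =
          (\<lambda>z. t * (bump R z * (z $ l * P k j z)))"
      proof
        fix z
        show "bump R z * (z $ l * partial j (\<lambda>z. g (x + t *\<^sub>R z) $ k) z) =
            t * (bump R z * (z $ l * P k j z))"
        proof (cases "norm z \<le> R")
          case True
          then have "z \<in> E" using inD by (auto simp: E_def)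
          then show ?thesis using C(2)[of z j] by (simp add: E_def P_def)
        qed (simp add: bump_eq_0 R)
      qed
      then show ?thesis by (simp add: A_def)
    qed
    have "C1_on (\<lambda>z. g (x + t *\<^sub>R z) $ k) E" by (rule C(1)) (simp add: E_def)
    moreover have "cball 0 R \<subseteq> E" using inD by (auto simp: E_def)
    ultimately have "t * A k j l = t * A k l j"
      using integral_bump_angular_symmetric[OF _ E _ R, of "\<lambda>z. g (x + t *\<^sub>R z) $ k" l j]
      unfolding scaled by blast
    then show ?thesis using t by simp
  qed
  have sys: "P 0 0 z + P 2 2 z - P 1 1 z - P 3 3 z = 0" "P 0 1 z + P 1 0 z - P 2 3 z - P 3 2 z = 0"
    "P 0 2 z + P 3 1 z - P 1 3 z - P 2 0 z = 0" "P 0 3 z + P 1 2 z + P 2 1 z + P 3 0 z = 0"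
    if "z \<in> cball 0 R" for z
    using g inD[OF that] by (simp_all add: cimmino_system_def Let_def P_def)
  \<comment> \<open>Any linear relation between four of the partial derivatives passes to the moments.\<close>
  have comb: "a * A k1 j1 l + b * A k2 j2 l + c * A k3 j3 l + d * A k4 j4 l = 0"
    if "\<And>z. z \<in> cball 0 R \<Longrightarrow> a * P k1 j1 z + b * P k2 j2 z + c * P k3 j3 z + d * P k4 j4 z = 0"
    for a b c d k1 j1 k2 j2 k3 j3 k4 j4 l
  proof -
    let ?S = "\<lambda>z. a * (bump R z * (z $ l * P k1 j1 z)) + b * (bump R z * (z $ l * P k2 j2 z))
       + c * (bump R z * (z $ l * P k3 j3 z)) + d * (bump R z * (z $ l * P k4 j4 z))"
    have "(?S has_integral (a * A k1 j1 l + b * A k2 j2 l + c * A k3 j3 l + d * A k4 j4 l)) UNIV"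
      by (intro has_integral_add has_integral_mult_right I)
    moreover have "?S z = 0" for z
    proof (cases "norm z \<le> R")
      case True
      have "?S z = bump R z * z $ l * (a * P k1 j1 z + b * P k2 j2 z + c * P k3 j3 z + d * P k4 j4 z)"
        by (simp add: algebra_simps)
      then show ?thesis using that[of z] True by simp
    qed (simp add: bump_eq_0 R)
    ultimately show ?thesis by (simp add: has_integral_0_eq)
  qed
  have e1: "A 0 0 l + A 2 2 l - A 1 1 l - A 3 3 l = 0" for l
    using comb[of 1 0 0 1 2 2 "-1" 1 1 "-1" 3 3 l] sys(1) by simp
  have e2: "A 0 1 l + A 1 0 l - A 2 3 l - A 3 2 l = 0" for l
    using comb[of 1 0 1 1 1 0 "-1" 2 3 "-1" 3 2 l] sys(2) by simp
  have e3: "A 0 2 l + A 3 1 l - A 1 3 l - A 2 0 l = 0" for l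
    using comb[of 1 0 2 1 3 1 "-1" 1 3 "-1" 2 0 l] sys(3) by simp
  have e4: "A 0 3 l + A 1 2 l + A 2 1 l + A 3 0 l = 0" for l
    using comb[of 1 0 3 1 1 2 1 2 1 1 3 0 l] sys(4) by simp
  have s: "A k 1 0 = A k 0 1" "A k 2 0 = A k 0 2" "A k 3 0 = A k 0 3" "A k 2 1 = A k 1 2"
    "A k 3 1 = A k 1 3" "A k 3 2 = A k 2 3" for k
    by (rule sym)+
  have trace: "\<forall>k. A k 0 0 + A k 1 1 + A k 2 2 + A k 3 3 = 0"
    unfolding all_index4
    using e1[of 0] e1[of 1] e1[of 2] e1[of 3] e2[of 0] e2[of 1] e2[of 2] e2[of 3]
      e3[of 0] e3[of 1] e3[of 2] e3[of 3] e4[of 0] e4[of 1] e4[of 2] e4[of 3]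
      s[of 0] s[of 1] s[of 2] s[of 3] by linarith
  have "((\<lambda>z. bump R z * (z $ 0 * P i 0 z) + bump R z * (z $ 1 * P i 1 z) + bump R z * (z $ 2 * P i 2 z)
      + bump R z * (z $ 3 * P i 3 z)) has_integral (A i 0 0 + A i 1 1 + A i 2 2 + A i 3 3)) UNIV"
    by (intro has_integral_add I)
  moreover have "bump R z * (grad (\<lambda>y. g y $ i) (x + t *\<^sub>R z) \<bullet> z) =
      bump R z * (z $ 0 * P i 0 z) + bump R z * (z $ 1 * P i 1 z) + bump R z * (z $ 2 * P i 2 z)
      + bump R z * (z $ 3 * P i 3 z)" for z
    by (simp add: inner_real4 grad_def P_def algebra_simps)
  ultimately show ?thesis using trace by (simp add: integral_unique)
qed

definition bump_mass :: "real \<Rightarrow> real"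
  where "bump_mass R = integral UNIV (bump R)"

lemma bump_mass_pos:
  assumes "0 < R" shows "0 < bump_mass R"
proof -
  obtain a where a: "cball (0::real^4) R \<subseteq> box (- a) a"
    using bounded_subset_box_symmetric bounded_cball by blast
  have sub: "cball (0::real^4) R \<subseteq> cbox (- a) a" using a box_subset_cbox by blast
  have I: "(bump R has_integral bump_mass R) (cbox (- a) a)"
    unfolding bump_mass_def
    by (rule integral_compact_support(2)[OF _ _ sub]) (use assms bump_eq_0 in \<open>auto intro: continuous_intros\<close>)
  have z: "(0::real^4) \<in> box (- a) a" "(0::real^4) \<in> cbox (- a) a" using a sub assms by auto
  have "bump_mass R \<noteq> 0"
  proof
    assume "bump_mass R = 0"
    with I have "integral (cbox (- a) a) (bump R) = 0" by (simp add: integral_unique)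
    then have "bump R 0 = 0"
      using z by (subst (asm) integral_cbox_eq_0_iff) (auto intro: continuous_intros bump_nonneg)
    with assms show False by (simp add: bump_def trunc_def)
  qed
  moreover have "0 \<le> bump_mass R"
    using has_integral_nonneg[OF I bump_nonneg] .
  ultimately show ?thesis by simp
qed

text \<open>
  The mean of \<open>g (x + t z)\<close> over the bump function does not depend on \<open>t\<close>; at \<open>t = 0\<close> it is \<open>g x\<close> times the
  mass.
\<close>

lemma monogenic_mean_value:
  assumes g: "monogenic_on D g" and D: "open D" "cball x R \<subseteq> D" and R: "0 < R"
  shows "integral UNIV (\<lambda>z. bump R z * g (x + z) $ i) = bump_mass R * g x $ i"
proof -
  let ?u = "\<lambda>y. g y $ i"
  have C1: "C1_on ?u D" using g by blast
  have inD: "x + t *\<^sub>R z \<in> D" if "z \<in> cball 0 R" "t \<in> {0..1}" for z t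
  proof -
    have "\<bar>t\<bar> * norm z \<le> norm z" using that by (simp add: mult_left_le_one_le)
    then show ?thesis using that D(2) by (auto simp: subset_iff dist_norm)
  qed
  obtain a where a: "cball (0::real^4) R \<subseteq> cbox (- a) a"
    using bounded_subset_cbox_symmetric bounded_cball by blast
  define h where "h t = integral (cbox (- a) a) (\<lambda>z. bump R z * ?u (x + t *\<^sub>R z))" for t
  let ?d = "\<lambda>t z. bump R z * (grad ?u (x + t *\<^sub>R z) \<bullet> z)"
  have cont: "continuous_on (cball 0 R) (\<lambda>z. ?u (x + t *\<^sub>R z))"
    and contd: "continuous_on (cball 0 R) (\<lambda>z. grad ?u (x + t *\<^sub>R z) \<bullet> z)" if "t \<in> {0..1}" for t
  proof -
    have img: "(\<lambda>z. x + t *\<^sub>R z) ` cball 0 R \<subseteq> D" by (rule image_subsetI) (rule inD[OF _ that])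
    have c: "continuous_on (cball 0 R) (\<lambda>z. x + t *\<^sub>R z)" by (intro continuous_intros)
    show "continuous_on (cball 0 R) (\<lambda>z. ?u (x + t *\<^sub>R z))"
      by (rule continuous_on_compose2[OF C1_on_imp_continuous_on[OF C1] c img])
    show "continuous_on (cball 0 R) (\<lambda>z. grad ?u (x + t *\<^sub>R z) \<bullet> z)"
      by (intro continuous_on_inner continuous_on_id continuous_on_compose2[OF _ c img])
         (use C1 in \<open>auto simp: C1_on_grad\<close>)
  qed
  have UN: "integral (cbox (- a) a) (\<lambda>z. bump R z * v z) = integral UNIV (\<lambda>z. bump R z * v z)"
    if "continuous_on (cball 0 R) v" for v
    by (intro integral_unique integral_compact_support(2)[OF _ _ a] bump_cutoff that)
       (use R bump_eq_0 in auto)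
  have hder: "(h has_real_derivative integral (cbox (- a) a) (?d t)) (at t within {0..1})" if "t \<in> {0..1}" for t
    unfolding h_def
  proof (rule leibniz_rule_field_derivative[OF _ _ _ that])
    show "(\<lambda>z. bump R z * ?u (x + t *\<^sub>R z)) integrable_on cbox (- a) a" if "t \<in> {0..1}" for t
      by (intro integrable_continuous continuous_on_subset[OF bump_cutoff(1)[OF cont[OF that]]])
         (use R in auto)
    show "((\<lambda>t. bump R z * ?u (x + t *\<^sub>R z)) has_real_derivative ?d t z) (at t within {0..1})"
      if "t \<in> {0..1}" for t z
    proof (cases "norm z \<le> R")
      case True
      then have "x + t *\<^sub>R z \<in> D" by (intro inD that) simp
      then have "?u differentiable (at (x + t *\<^sub>R z))" using C1 by (simp add: C1_on_def)
      from line_derivative[OF this, of z]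
      have "((\<lambda>s. ?u (x + (s + t) *\<^sub>R z)) has_real_derivative grad ?u (x + t *\<^sub>R z) \<bullet> z) (at 0)"
        by (simp add: algebra_simps)
      then have "((\<lambda>t. ?u (x + t *\<^sub>R z)) has_real_derivative grad ?u (x + t *\<^sub>R z) \<bullet> z) (at t)"
        using DERIV_shift[of "\<lambda>t. ?u (x + t *\<^sub>R z)" _ 0 t] by simp
      then show ?thesis by (rule DERIV_cmult[OF has_field_derivative_at_within])
    qed (use R in \<open>simp add: bump_eq_0\<close>)
    have "continuous_on ({0..1} \<times> UNIV) (\<lambda>p. bump R (snd p) * (grad ?u (x + fst p *\<^sub>R snd p) \<bullet> snd p))"
    proof (rule continuous_on_cutoff[where n = "\<lambda>p. norm (snd p)" and R = R])
      show "continuous_on {p \<in> {0..1} \<times> UNIV. norm (snd p) \<le> R}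
         (\<lambda>p. grad ?u (x + fst p *\<^sub>R snd p) \<bullet> snd p)"
      proof (rule continuous_on_inner[OF continuous_on_compose2[of D "grad ?u" _ "\<lambda>p. x + fst p *\<^sub>R snd p"]])
        show "continuous_on D (grad ?u)" using C1 by (simp add: C1_on_grad)
        show "(\<lambda>p. x + fst p *\<^sub>R snd p) ` {p \<in> {0..1} \<times> UNIV. norm (snd p) \<le> R} \<subseteq> D"
          by (rule image_subsetI) (rule inD, auto)
      qed (intro continuous_intros)+
      show "continuous_on ({0..1::real} \<times> UNIV) (\<lambda>p. bump R (snd p))"
        by (rule continuous_on_compose2[OF continuous_on_bump[of UNIV]]) (auto intro!: continuous_intros)
    qed (use R bump_eq_0 in \<open>auto intro!: closed_Times continuous_intros\<close>)
    then show "continuous_on ({0..1} \<times> cbox (- a) a) (\<lambda>(t, z). ?d t z)"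
      unfolding split_beta by (rule continuous_on_subset) auto
  qed auto
  have "integral (cbox (- a) a) (?d t) = 0" if "t \<in> {0<..1}" for t
    using UN[OF contd, of t] monogenic_radial_integral_eq_0[OF g D, of t i] R that by simp
  then have h: "(h has_real_derivative 0) (at t within {0..1})" if "t \<in> {0<..1}" for t
    using hder[of t] that by simp
  have "continuous_on {0..1} h"
    using hder DERIV_continuous unfolding continuous_on_eq_continuous_within by blast
  then have "h 1 = h 0"
  proof (rule DERIV_isconst_end[OF zero_less_one])
    fix t :: real assume "0 < t" "t < 1"
    then show "(h has_real_derivative 0) (at t)" using h[of t] by (simp add: at_within_Icc_at)
  qed
  moreover have "h 0 = bump_mass R * g x $ i" "h 1 = integral UNIV (\<lambda>z. bump R z * g (x + z) $ i)"
    unfolding h_def using UN[OF cont, of 0] UN[OF cont, of 1]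
    by (simp_all add: bump_mass_def)
  ultimately show ?thesis by simp
qed

lemma monogenic_bump_representation:
  assumes g: "monogenic_on D g" and "open D" and R: "0 < R"
    and K: "cball x R \<subseteq> cbox p q" "cbox p q \<subseteq> D"
  shows "((\<lambda>y. bump R (y - x) * g y $ i) has_integral bump_mass R * g x $ i) (cbox p q)"
proof -
  have cont: "continuous_on (cball 0 R) (\<lambda>z. g (x + z) $ i)"
  proof (rule continuous_on_compose2[of D "\<lambda>y. g y $ i"])
    show "continuous_on D (\<lambda>y. g y $ i)" using g C1_on_imp_continuous_on by blast
    show "(\<lambda>z. x + z) ` cball 0 R \<subseteq> D" using K by (auto simp: subset_iff dist_norm)
  qed (intro continuous_intros)
  have "((\<lambda>z. bump R z * g (x + z) $ i) has_integral bump_mass R * g x $ i) (cbox (p - x) (q - x))"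
    unfolding monogenic_mean_value[OF g \<open>open D\<close> order_trans[OF K] R, symmetric]
  proof (rule integral_compact_support(2))
    show "cball 0 R \<subseteq> cbox (p - x) (q - x)"
    proof
      fix z assume "z \<in> cball (0::real^4) R"
      then have "x + z \<in> cbox p q" using K(1) by (auto simp: subset_iff dist_norm)
      then show "z \<in> cbox (p - x) (q - x)" by (auto simp: mem_box inner_simps)
    qed
  qed (use bump_cutoff(1)[OF cont] R bump_eq_0 in auto)
  from has_integral_shift_cbox[OF this, of "- x"] show ?thesis by simp
qed

text \<open>
  In the representation of \<open>g x\<close> as the integral of \<open>bump (y - x) g y\<close>, the kernel is bounded, which bounds
  the values of \<open>g\<close>, and it is Lipschitz in \<open>x\<close>. The second fact makes \<open>g\<close> Lipschitz with a constant
  proportional to the integral of \<open>\<bar>g\<bar>\<close>, and that constant bounds the partial derivatives, which are known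
  to exist.
\<close>

lemma monogenic_local_estimate:
  assumes D: "open D" and R: "0 < R" and K: "cball x0 (2 * R) \<subseteq> cbox p q" "cbox p q \<subseteq> D"
  obtains C where "0 \<le> C"
    and "\<And>g i x. monogenic_on D g \<Longrightarrow> x \<in> ball x0 R \<Longrightarrow>
      \<bar>g x $ i\<bar> \<le> C * integral (cbox p q) (\<lambda>y. \<bar>g y $ i\<bar>)"
    and "\<And>g i j x. monogenic_on D g \<Longrightarrow> x \<in> ball x0 R \<Longrightarrow>
      \<bar>partial j (\<lambda>y. g y $ i) x\<bar> \<le> C * integral (cbox p q) (\<lambda>y. \<bar>g y $ i\<bar>)"
proof -
  obtain S where S: "\<And>y. y \<in> cbox p q \<Longrightarrow> norm (y - x0) \<le> S"
    using bounded_cbox[of p q] bounded_any_center[of "cbox p q" x0]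
    by (metis dist_commute dist_norm)
  have "x0 \<in> cbox p q" by (rule subsetD[OF K(1)]) (use R in simp)
  from S[OF this] have S0: "0 \<le> S" by simp
  define L where "L = 4 * R\<^sup>2 * (S + R)"
  define C where "C = max (R ^ 4) L / bump_mass R"
  have m: "0 < bump_mass R" using bump_mass_pos[OF R] .
  have L0: "0 \<le> L" using S0 R by (simp add: L_def)
  have C0: "0 \<le> C" using m L0 by (simp add: C_def)
  have ball: "cball x R \<subseteq> cbox p q" if "x \<in> ball x0 R" for x
  proof -
    have "cball x R \<subseteq> cball x0 (2 * R)" using that by (simp add: cball_subset_cball_iff dist_commute)
    then show ?thesis using K(1) by blast
  qed
  show ?thesis
  proof (rule that[OF C0])
    fix g i x assume g: "monogenic_on D g" and x: "x \<in> ball x0 R"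
    let ?I = "integral (cbox p q) (\<lambda>y. \<bar>g y $ i\<bar>)"
    have cg: "continuous_on (cbox p q) (\<lambda>y. \<bar>g y $ i\<bar>)"
    proof -
      have "continuous_on D (\<lambda>y. g y $ i)" using g C1_on_imp_continuous_on by blast
      from continuous_on_rabs[OF continuous_on_subset[OF this K(2)]] show ?thesis .
    qed
    have Iint: "(\<lambda>y. c * \<bar>g y $ i\<bar>) integrable_on cbox p q" for c
      by (intro integrable_continuous continuous_intros cg)
    note rep = monogenic_bump_representation[OF g D R ball K(2), of _ i]
    have "\<bar>bump_mass R * g x $ i\<bar> \<le> integral (cbox p q) (\<lambda>y. R ^ 4 * \<bar>g y $ i\<bar>)"
      unfolding integral_unique[OF rep[OF x], symmetric] real_norm_def[symmetric]
      by (rule integral_norm_bound_integral)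
         (use rep[OF x] Iint bump_nonneg bump_le in \<open>auto simp: abs_mult intro!: mult_right_mono\<close>)
    then have "bump_mass R * \<bar>g x $ i\<bar> \<le> R ^ 4 * ?I"
      using m by (simp add: abs_mult)
    also have "\<dots> \<le> max (R ^ 4) L * ?I"
      by (intro mult_right_mono integral_nonneg integrable_continuous cg) auto
    finally show "\<bar>g x $ i\<bar> \<le> C * ?I"
      using m by (simp add: C_def field_simps)
    fix j
    have lip: "\<bar>g x' $ i - g x $ i\<bar> \<le> C * ?I * norm (x' - x)" if x': "x' \<in> ball x0 R" for x'
    proof -
      have "((\<lambda>y. (bump R (y - x') - bump R (y - x)) * g y $ i) has_integral
          bump_mass R * (g x' $ i - g x $ i)) (cbox p q)"
        using has_integral_diff[OF rep[OF x'] rep[OF x]] by (simp add: algebra_simps)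
      note J = this
      have "norm (integral (cbox p q) (\<lambda>y. (bump R (y - x') - bump R (y - x)) * g y $ i)) \<le>
          integral (cbox p q) (\<lambda>y. (L * norm (x' - x)) * \<bar>g y $ i\<bar>)"
      proof (rule integral_norm_bound_integral)
        fix y assume y: "y \<in> cbox p q"
        have n: "norm (y - z) \<le> S + R" if "z \<in> ball x0 R" for z
          using norm_triangle_ineq[of "y - x0" "x0 - z"] S[OF y] that by (simp add: dist_norm)
        have "\<bar>bump R (y - x') - bump R (y - x)\<bar> \<le> L * norm (x' - x)"
          using bump_lipschitz[OF n[OF x'] n[OF x], of R] by (simp add: L_def norm_minus_commute)
        then show "norm ((bump R (y - x') - bump R (y - x)) * g y $ i) \<le>
            L * norm (x' - x) * \<bar>g y $ i\<bar>"
          by (simp add: abs_mult mult_right_mono)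
      qed (use J Iint in auto)
      then have "bump_mass R * \<bar>g x' $ i - g x $ i\<bar> \<le> (L * norm (x' - x)) * ?I"
        unfolding integral_unique[OF J] using m by (simp add: abs_mult)
      also have "\<dots> \<le> (max (R ^ 4) L * norm (x' - x)) * ?I"
        by (intro mult_right_mono integral_nonneg integrable_continuous cg) auto
      finally show ?thesis
        using m by (simp add: C_def field_simps)
    qed
    have "x \<in> D" using ball[OF x] R K(2) by force
    then have "(\<lambda>y. g y $ i) differentiable (at x)" using g by (simp add: C1_on_def)
    then have d: "((\<lambda>s. g (x + s *\<^sub>R axis j 1) $ i) has_real_derivative partial j (\<lambda>y. g y $ i) x) (at 0)"
      using line_derivative[of "\<lambda>y. g y $ i" x "axis j 1"] by (simp add: inner_axis grad_def)
    have lim: "((\<lambda>s. \<bar>(g (x + s *\<^sub>R axis j 1) $ i - g x $ i) / s\<bar>) \<longlongrightarrow> \<bar>partial j (\<lambda>y. g y $ i) x\<bar>) (at 0)"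
      using tendsto_rabs[OF d[unfolded DERIV_def]] by simp
    have near: "\<forall>\<^sub>F s in at 0. x + s *\<^sub>R axis j 1 \<in> ball x0 R"
    proof -
      have "((\<lambda>s. x + s *\<^sub>R axis j 1) \<longlongrightarrow> x + 0 *\<^sub>R axis j (1::real)) (at 0)"
        by (intro tendsto_intros)
      then show ?thesis using x by (intro topological_tendstoD) auto
    qed
    show "\<bar>partial j (\<lambda>y. g y $ i) x\<bar> \<le> C * ?I"
    proof (rule tendsto_upperbound[OF lim])
      show "\<forall>\<^sub>F s in at 0. \<bar>(g (x + s *\<^sub>R axis j 1) $ i - g x $ i) / s\<bar> \<le> C * ?I"
        using near eventually_neq_at_within[of 0 0 UNIV]
      proof eventually_elim
        case (elim s)
        then have "\<bar>g (x + s *\<^sub>R axis j 1) $ i - g x $ i\<bar> \<le> C * ?I * \<bar>s\<bar>"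
          using lip[OF elim(1)] by simp
        then show ?case using elim(2) by (simp add: abs_divide divide_le_eq)
      qed
    qed simp
  qed
qed

section \<open>The Riesz representation theorem in spaces of functions\<close>

lemma quadratic_nonneg_imp_bound:
  fixes a b c :: real
  assumes pos: "\<And>t. 0 \<le> a + 2 * t * b + t\<^sup>2 * c" and c: "0 \<le> c"
  shows "\<bar>b\<bar> \<le> sqrt a * sqrt c"
proof -
  have "b\<^sup>2 \<le> a * c"
  proof (cases "c = 0")
    case True
    have "b = 0"
    proof (rule ccontr)
      assume "b \<noteq> 0"
      then show False using pos[of "- (a + 1) / (2 * b)"] True by (simp add: field_simps)
    qed
    then show ?thesis using True by simp
  next
    case False
    with c have "0 < c" by simp
    \<comment> \<open>The minimum over \<open>t\<close> is attained at \<open>- b / c\<close>.\<close>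
    have "a + 2 * (- b / c) * b + (- b / c)\<^sup>2 * c = (a * c - b\<^sup>2) / c"
      using False by (simp add: field_simps power2_eq_square)
    with pos[of "- b / c"] have "0 \<le> (a * c - b\<^sup>2) / c" by simp
    with \<open>0 < c\<close> show ?thesis by (simp add: zero_le_divide_iff)
  qed
  then have "sqrt (b\<^sup>2) \<le> sqrt (a * c)" by (rule real_sqrt_le_mono)
  then show ?thesis by (simp add: real_sqrt_mult)
qed

text \<open>
  The representing function minimizes \<open>J f = \<parallel>f\<parallel>\<^sup>2 - 2 l f\<close>. By the parallelogram identity a minimizing
  sequence is Cauchy. To avoid continuity of \<open>J\<close>, the first variation is estimated along the sequence:
  \<open>J (u\<^sub>n + t f) \<ge> inf J\<close> for all \<open>t\<close> bounds \<open>\<bar>l f - \<langle>u\<^sub>n, f\<rangle>\<bar>\<close> by a discriminant.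
\<close>

lemma riesz_representation_function_space:
  fixes X :: "('a \<Rightarrow> 'b::real_vector) set" and N :: "('a \<Rightarrow> 'b) \<Rightarrow> real"
    and ip :: "('a \<Rightarrow> 'b) \<Rightarrow> ('a \<Rightarrow> 'b) \<Rightarrow> real"
  assumes banach: "real_banach_space X N"
    and N: "\<And>f. f \<in> X \<Longrightarrow> (N f)\<^sup>2 = ip f f"
    and sym: "\<And>f g. f \<in> X \<Longrightarrow> g \<in> X \<Longrightarrow> ip f g = ip g f"
    and add: "\<And>f g h. f \<in> X \<Longrightarrow> g \<in> X \<Longrightarrow> h \<in> X \<Longrightarrow> ip (\<lambda>x. f x + g x) h = ip f h + ip g h"
    and scale: "\<And>t f h. f \<in> X \<Longrightarrow> h \<in> X \<Longrightarrow> ip (\<lambda>x. t *\<^sub>R f x) h = t * ip f h"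
    and l_add: "\<And>f g. f \<in> X \<Longrightarrow> g \<in> X \<Longrightarrow> l (\<lambda>x. f x + g x) = l f + l g"
    and l_scale: "\<And>t f. f \<in> X \<Longrightarrow> l (\<lambda>x. t *\<^sub>R f x) = t * l f"
    and bound: "\<And>f. f \<in> X \<Longrightarrow> \<bar>l f\<bar> \<le> C * N f"
  obtains p where "p \<in> X" and "\<And>f. f \<in> X \<Longrightarrow> ip p f = l f"
proof -
  note B = banach[unfolded real_banach_space_def]
  have X_add: "(\<lambda>x. f x + g x) \<in> X" if "f \<in> X" "g \<in> X" for f g using B that by blast
  have X_lin: "(\<lambda>x. f x + t *\<^sub>R g x) \<in> X" if "f \<in> X" "g \<in> X" for f g t
  proof -
    have "(\<lambda>x. t *\<^sub>R g x) \<in> X" using B that by blast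
    from X_add[OF that(1) this] show ?thesis .
  qed
  have X_scale: "(\<lambda>x. t *\<^sub>R g x) \<in> X" if "g \<in> X" for g t using B that by blast
  have X_zero: "(\<lambda>x. 0) \<in> X" using B by blast
  have N0: "0 \<le> N f" if "f \<in> X" for f using B that by blast
  have lin: "ip (\<lambda>x. f x + t *\<^sub>R g x) h = ip f h + t * ip g h" if "f \<in> X" "g \<in> X" "h \<in> X" for f g h t
    using add[of f "\<lambda>x. t *\<^sub>R g x" h] scale that X_scale by simp
  have l_lin: "l (\<lambda>x. f x + t *\<^sub>R g x) = l f + t * l g" if "f \<in> X" "g \<in> X" for f g t
    using l_add[of f "\<lambda>x. t *\<^sub>R g x"] l_scale that X_scale by simp
  have lin2: "ip (\<lambda>x. f x + t *\<^sub>R g x) (\<lambda>x. f x + t *\<^sub>R g x) = ip f f + 2 * t * ip f g + t\<^sup>2 * ip g g"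
    if "f \<in> X" "g \<in> X" for f g t
    using that X_lin[OF that, of t] lin[of f g "\<lambda>x. f x + t *\<^sub>R g x" t]
      sym[of f "\<lambda>x. f x + t *\<^sub>R g x"] sym[of g "\<lambda>x. f x + t *\<^sub>R g x"] lin[of f g f t] lin[of f g g t]
      sym[of g f] by (simp add: algebra_simps power2_eq_square)
  define J where "J f = ip f f - 2 * l f" for f
  have J_lin: "J (\<lambda>x. f x + t *\<^sub>R g x) = J f + 2 * t * (ip f g - l g) + t\<^sup>2 * ip g g"
    if "f \<in> X" "g \<in> X" for f g t
    using lin2[OF that, of t] l_lin[OF that, of t] by (simp add: J_def algebra_simps)
  have J_lower: "- C\<^sup>2 \<le> J f" if "f \<in> X" for f
  proof -
    have "0 \<le> (N f - C)\<^sup>2" by simp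
    then have "0 \<le> (N f)\<^sup>2 - 2 * (C * N f) + C\<^sup>2" by (simp add: power2_diff algebra_simps)
    with bound[OF that] N[OF that] show ?thesis by (simp add: J_def)
  qed
  define m where "m = Inf (J ` X)"
  have bdd: "bdd_below (J ` X)" using J_lower by (intro bdd_belowI2)
  have m_le: "m \<le> J f" if "f \<in> X" for f
    unfolding m_def using bdd that by (intro cInf_lower) auto
  have "\<exists>f\<in>X. J f < m + 1 / real (Suc n)" for n
    using cInf_lessD[of "J ` X" "m + 1 / real (Suc n)"] X_zero by (force simp: m_def)
  then obtain u where u: "\<And>n. u n \<in> X" "\<And>n. J (u n) < m + 1 / real (Suc n)" by metis
  have diff: "(\<lambda>x. f x - g x) \<in> X" if "f \<in> X" "g \<in> X" for f g
    using X_lin[OF that, of "-1"] by simp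
  have para: "(N (\<lambda>x. f x - g x))\<^sup>2 \<le> 2 * (J f - m) + 2 * (J g - m)" if "f \<in> X" "g \<in> X" for f g
  proof -
    let ?d = "\<lambda>x. f x - g x"
    have d: "?d \<in> X" using diff that by blast
    have mid: "(\<lambda>x. g x + (1/2) *\<^sub>R ?d x) \<in> X" by (rule X_lin[OF that(2) d])
    have "J f = J (\<lambda>x. g x + 1 *\<^sub>R ?d x)" by simp
    also have "\<dots> = J g + 2 * (ip g ?d - l ?d) + ip ?d ?d"
      using J_lin[OF that(2) d, of 1] by simp
    finally have a: "J f = J g + 2 * (ip g ?d - l ?d) + ip ?d ?d" .
    have "m \<le> J g + (ip g ?d - l ?d) + ip ?d ?d / 4"
      using m_le[OF mid] J_lin[OF that(2) d, of "1/2"] by (simp add: power2_eq_square)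
    with a show ?thesis unfolding N[OF d] by argo
  qed
  have cauchy: "\<exists>M. \<forall>k\<ge>M. \<forall>n\<ge>M. N (\<lambda>x. u k x - u n x) < e" if "0 < e" for e
  proof -
    obtain M where M: "1 / real (Suc M) < e\<^sup>2 / 4"
      using reals_Archimedean[of "e\<^sup>2 / 4"] \<open>0 < e\<close> by (auto simp: inverse_eq_divide)
    have "N (\<lambda>x. u k x - u n x) < e" if "k \<ge> M" "n \<ge> M" for k n
    proof -
      have small: "J (u j) - m < e\<^sup>2 / 4" if "j \<ge> M" for j
      proof -
        have "1 / real (Suc j) \<le> 1 / real (Suc M)" using that by (intro divide_left_mono) auto
        then show ?thesis using u(2)[of j] M by linarith
      qed
      have "(N (\<lambda>x. u k x - u n x))\<^sup>2 < e\<^sup>2"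
        using para[OF u(1) u(1), of k n] small[OF that(1)] small[OF that(2)] by argo
      then show ?thesis using \<open>0 < e\<close> by (simp add: power_less_imp_less_base)
    qed
    then show ?thesis by blast
  qed
  have "\<forall>u::nat \<Rightarrow> 'a \<Rightarrow> 'b.
       (\<forall>n. u n \<in> X) \<and> (\<forall>e>0. \<exists>M. \<forall>m\<ge>M. \<forall>n\<ge>M. N (\<lambda>x. u m x - u n x) < e)
       \<longrightarrow> (\<exists>f\<in>X. (\<lambda>n. N (\<lambda>x. u n x - f x)) \<longlonglongrightarrow> 0)"
    using B by (elim conjE) assumption
  from mp[OF spec[OF this, of u]] obtain p
    where p: "p \<in> X" and lim: "(\<lambda>n. N (\<lambda>x. u n x - p x)) \<longlonglongrightarrow> 0"
    using u(1) cauchy by auto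
  have critical: "ip p f = l f" if f: "f \<in> X" for f
  proof -
    have "\<bar>l f - ip (u n) f\<bar> \<le> sqrt (J (u n) - m) * sqrt (ip f f)" for n
    proof -
      have "0 \<le> (J (u n) - m) + 2 * t * (ip (u n) f - l f) + t\<^sup>2 * ip f f" for t
        using m_le[OF X_lin[OF u(1) f, of n t]] J_lin[OF u(1) f, of n t] by simp
      moreover have "0 \<le> ip f f" using N[OF f] by (metis zero_le_power2)
      ultimately have "\<bar>ip (u n) f - l f\<bar> \<le> sqrt (J (u n) - m) * sqrt (ip f f)"
        by (rule quadratic_nonneg_imp_bound)
      then show ?thesis by (simp add: abs_minus_commute)
    qed
    moreover have "\<bar>ip (u n) f - ip p f\<bar> \<le> N (\<lambda>x. u n x - p x) * N f" for n
    proof -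
      let ?d = "\<lambda>x. u n x - p x"
      have d: "?d \<in> X" using diff u(1) p by blast
      have "0 \<le> ip ?d ?d + 2 * t * ip ?d f + t\<^sup>2 * ip f f" for t
        using N[OF X_lin[OF d f, of t]] lin2[OF d f, of t] by (metis zero_le_power2)
      moreover have "0 \<le> ip f f" using N[OF f] by (metis zero_le_power2)
      ultimately have "\<bar>ip ?d f\<bar> \<le> sqrt (ip ?d ?d) * sqrt (ip f f)"
        by (rule quadratic_nonneg_imp_bound)
      moreover have "ip ?d f = ip (u n) f - ip p f"
        using lin[OF u(1) p f, of n "-1"] by simp
      ultimately show ?thesis using N[OF d, symmetric] N[OF f, symmetric] N0[OF d] N0[OF f] by simp
    qed
    ultimately have le: "\<bar>l f - ip p f\<bar> \<le>
        sqrt (1 / real (Suc n)) * sqrt (ip f f) + N (\<lambda>x. u n x - p x) * N f" for n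
    proof -
      have "sqrt (J (u n) - m) \<le> sqrt (1 / real (Suc n))"
        using u(2)[of n] by (intro real_sqrt_le_mono) linarith
      then have "sqrt (J (u n) - m) * sqrt (ip f f) \<le> sqrt (1 / real (Suc n)) * sqrt (ip f f)"
        using N[OF f] by (intro mult_right_mono) (auto simp flip: N[OF f])
      with \<open>\<And>n. \<bar>l f - ip (u n) f\<bar> \<le> _ n\<close>[of n] \<open>\<And>n. \<bar>ip (u n) f - ip p f\<bar> \<le> _ n\<close>[of n]
      show ?thesis by linarith
    qed
    have "(\<lambda>n. sqrt (1 / real (Suc n)) * sqrt (ip f f) + N (\<lambda>x. u n x - p x) * N f)
        \<longlonglongrightarrow> sqrt 0 * sqrt (ip f f) + 0 * N f"
      by (intro tendsto_intros lim LIMSEQ_Suc[OF lim_1_over_n])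
    then have "\<bar>l f - ip p f\<bar> \<le> 0"
      using le by (intro LIMSEQ_le_const) auto
    then show ?thesis by simp
  qed
  show ?thesis using that[OF p critical] .
qed

section \<open>The Cimmino operator and right multiplication by units\<close>

lemma partial_add:
  "g differentiable (at x) \<Longrightarrow> h differentiable (at x) \<Longrightarrow>
    partial j (\<lambda>y. g y + h y) x = partial j g x + partial j h x"
  using has_derivative_partial(2)[of "\<lambda>y. g y + h y" "grad g x + grad h x" x j]
    has_derivative_add[OF has_derivative_grad has_derivative_grad, of g x h]
  by (simp add: inner_add_left grad_def)

lemma partial_cmult:
  "g differentiable (at x) \<Longrightarrow> partial j (\<lambda>y. c * g y) x = c * partial j g x"
  using has_derivative_partial(2)[of "\<lambda>y. c * g y" "c *\<^sub>R grad g x" x j]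
    has_derivative_mult_right[OF has_derivative_grad, of g x c]
  by (simp add: grad_def)

lemma partial_const [simp]: "partial j (\<lambda>y. c) x = 0"
  using has_derivative_partial(2)[of "\<lambda>y. c" 0 x j] by simp

lemma C1_on_const: "C1_on (\<lambda>y. c) D"
  by (simp add: C1_on_def)

lemma C1_on_add: "C1_on g D \<Longrightarrow> C1_on h D \<Longrightarrow> C1_on (\<lambda>y. g y + h y) D"
  unfolding C1_on_def
  by (auto intro: differentiable_add continuous_on_eq[OF continuous_on_add] simp: partial_add)

lemma C1_on_cmult: "C1_on g D \<Longrightarrow> C1_on (\<lambda>y. c * g y) D"
  unfolding C1_on_def
  by (auto intro: differentiable_mult continuous_on_eq[OF continuous_on_mult_left[of _ _ c]] simp: partial_cmult)

lemma partial_minus: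
  "g differentiable (at x) \<Longrightarrow> partial j (\<lambda>y. - g y) x = - partial j g x"
  using partial_cmult[of g x j "-1"] by simp

lemma C1_on_minus: "C1_on g D \<Longrightarrow> C1_on (\<lambda>y. - g y) D"
  using C1_on_cmult[of g D "-1"] by simp

text \<open>
  Right multiplication by \<open>1, e\<^sub>1, e\<^sub>2, e\<^sub>3\<close> for \<open>i = 0, 1, 2, 3\<close>, in the coordinates of the values of
  solutions; \<open>runit_cnj\<close> is right multiplication by the conjugate units, its adjoint.
\<close>

definition runit :: "4 \<Rightarrow> real^4 \<Rightarrow> real^4"
  where "runit i v =
    (if i = 0 then v
     else if i = 1 then tup4 (- v $ 1) (v $ 0) (v $ 3) (- v $ 2)
     else if i = 2 then tup4 (- v $ 2) (- v $ 3) (v $ 0) (v $ 1)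
     else tup4 (- v $ 3) (v $ 2) (- v $ 1) (v $ 0))"

definition runit_cnj :: "4 \<Rightarrow> real^4 \<Rightarrow> real^4"
  where "runit_cnj i v = (if i = 0 then v else - runit i v)"

lemma runit_adjoint: "runit i u \<bullet> v = u \<bullet> runit_cnj i v"
  using index4_cases[of i] by (auto simp: runit_def runit_cnj_def inner_real4)

lemma runit_cnj_nth_0: "runit_cnj i v $ 0 = v $ i"
  using index4_cases[of i] by (auto simp: runit_def runit_cnj_def)

lemma wform_nth: "wform D w f g $ i = (\<integral>y. (runit i (f y) \<bullet> g y) * w y \<partial>lebesgue_on D)"
  using index4_cases[of i] by (auto simp: wform_def runit_def inner_real4 algebra_simps)

text \<open>
  The coordinates of the quaternion \<open>\<Sum>\<^sub>j\<^sub>k P\<^sub>k\<^sub>j \<psi>\<^sub>j e\<^sub>k\<close>. The third one is the negative of the third line of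
  the system; with this sign, \<open>cim\<close> commutes with multiplication from the right. Writing the
  system as \<open>cim (\<partial>\<^sub>j f\<^sub>k + \<delta>\<^sub>j f\<^sub>k) = 0\<close> treats derivatives and coefficients alike.
\<close>

definition cim :: "(4 \<Rightarrow> 4 \<Rightarrow> real) \<Rightarrow> real^4"
  where "cim P = tup4 (P 0 0 + P 2 2 - P 1 1 - P 3 3) (P 0 1 + P 1 0 - P 2 3 - P 3 2)
    (P 2 0 + P 1 3 - P 0 2 - P 3 1) (P 0 3 + P 1 2 + P 2 1 + P 3 0)"

lemma tup4_eq_0_iff: "tup4 a b c d = 0 \<longleftrightarrow> a = 0 \<and> b = 0 \<and> c = 0 \<and> d = 0"
  by (auto simp: vec_eq_iff all_index4)

lemma cimmino_system_iff:
  "cimmino_system D \<delta> f \<longleftrightarrow>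
    (\<forall>x\<in>D. cim (\<lambda>k j. partial j (\<lambda>y. f y $ k) x + \<delta> x $ j * f x $ k) = 0)"
  unfolding cimmino_system_def Let_def cim_def tup4_eq_0_iff
  by (intro ball_cong refl arg_cong2[where f = "(\<and>)"]) argo+

lemma cim_zero: "cim (\<lambda>k j. 0) = 0"
  by (simp add: cim_def tup4_eq_0_iff)

lemma cim_add: "cim (\<lambda>k j. P k j + Q k j) = cim P + cim Q"
  by (simp add: cim_def vec_eq_iff all_index4)

lemma cim_scale: "cim (\<lambda>k j. t * P k j) = t *\<^sub>R cim P"
  by (simp add: cim_def vec_eq_iff all_index4 algebra_simps)

lemma tendsto_cim:
  assumes "\<And>k j. ((\<lambda>n. P n k j) \<longlongrightarrow> Q k j) F"
  shows "((\<lambda>n. cim (P n)) \<longlongrightarrow> cim Q) F"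
proof (rule vec_tendstoI)
  show "((\<lambda>n. cim (P n) $ i) \<longlongrightarrow> cim Q $ i) F" for i
    using index4_cases[of i]
    by (elim disjE; simp add: cim_def; intro tendsto_add tendsto_diff assms)
qed

lemma cim_runit: "cim (\<lambda>k j. runit i (\<chi> k. P k j) $ k) = runit i (cim P)"
  using index4_cases[of i] by (auto simp: cim_def vec_eq_iff all_index4 runit_def)

lemma runit_zero [simp]: "runit i 0 = 0"
  using index4_cases[of i] by (auto simp: runit_def tup4_eq_0_iff)

section \<open>Weighted spaces for a gradient coefficient\<close>

locale gradient_cimmino =
  fixes D :: "(real^4) set" and \<delta> :: "real^4 \<Rightarrow> real^4" and \<phi> w :: "real^4 \<Rightarrow> real"
  assumes open_D: "open D"
    and potential: "x \<in> D \<Longrightarrow> (\<phi> has_derivative (\<lambda>h. \<delta> x \<bullet> h)) (at x)"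
    and cont_delta: "continuous_on D \<delta>"
    and cont_w: "continuous_on D w"
    and w_pos: "x \<in> D \<Longrightarrow> 0 < w x"
begin

abbreviation M where "M \<equiv> lebesgue_on D"
abbreviation X where "X \<equiv> cimmino_bergman D \<delta> w"
abbreviation N where "N \<equiv> wnorm D w"

definition ip :: "(real^4 \<Rightarrow> real^4) \<Rightarrow> (real^4 \<Rightarrow> real^4) \<Rightarrow> real"
  where "ip f g = (\<integral>y. (f y \<bullet> g y) * w y \<partial>M)"

lemma space_M [simp]: "space M = D"
  by simp

lemma D_lebesgue: "D \<in> sets lebesgue"
  using open_D by (simp add: borel_open)

lemma measurable_continuous: "continuous_on D u \<Longrightarrow> u \<in> borel_measurable M" for u :: "real^4 \<Rightarrow> real"
  by (rule continuous_imp_measurable_on_sets_lebesgue[OF _ D_lebesgue])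

lemma w_measurable: "w \<in> borel_measurable M"
  by (rule measurable_continuous[OF cont_w])

lemma X_imp_C1: "f \<in> X \<Longrightarrow> C1_on (\<lambda>y. f y $ k) D"
  and X_imp_system: "f \<in> X \<Longrightarrow> cimmino_system D \<delta> f"
  and X_outside: "f \<in> X \<Longrightarrow> x \<notin> D \<Longrightarrow> f x = 0"
  by (auto simp: cimmino_bergman_def)

lemma X_differentiable: "f \<in> X \<Longrightarrow> x \<in> D \<Longrightarrow> (\<lambda>y. f y $ k) differentiable (at x)"
  using X_imp_C1[of f k] by (simp add: C1_on_def)

lemma X_imp_wL2: "f \<in> X \<Longrightarrow> f \<in> wL2 D w"
  by (auto simp: cimmino_bergman_def wL2_def intro!: measurable_continuous C1_on_imp_continuous_on)

lemma wL2_integrable_product: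
  assumes "f \<in> wL2 D w" "g \<in> wL2 D w"
  shows "integrable M (\<lambda>y. f y $ i * g y $ j * w y)"
proof (rule Bochner_Integration.integrable_bound)
  show "integrable M (\<lambda>y. \<bar>f y $ i\<bar>\<^sup>2 * w y + \<bar>g y $ j\<bar>\<^sup>2 * w y)"
    using assms by (auto simp: wL2_def)
  have "f \<in> wL2 D w \<Longrightarrow> (\<lambda>y. f y $ i) \<in> borel_measurable M" for f i
    by (auto simp: wL2_def)
  then show "(\<lambda>y. f y $ i * g y $ j * w y) \<in> borel_measurable M"
    using assms w_measurable by (intro borel_measurable_times) auto
  show "AE y in M. norm (f y $ i * g y $ j * w y) \<le> norm (\<bar>f y $ i\<bar>\<^sup>2 * w y + \<bar>g y $ j\<bar>\<^sup>2 * w y)"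
  proof (rule AE_I2)
    fix y assume "y \<in> space M"
    then have w: "0 < w y" using w_pos by simp
    have "\<bar>a * b\<bar> \<le> a\<^sup>2 + b\<^sup>2" for a b :: real
    proof -
      have "0 \<le> (\<bar>a\<bar> - \<bar>b\<bar>)\<^sup>2" by simp
      then have "2 * (\<bar>a\<bar> * \<bar>b\<bar>) \<le> a\<^sup>2 + b\<^sup>2" by (simp add: power2_diff)
      moreover have "0 \<le> \<bar>a\<bar> * \<bar>b\<bar>" by simp
      ultimately show ?thesis unfolding abs_mult by linarith
    qed
    then have "\<bar>f y $ i * g y $ j\<bar> * w y \<le> ((f y $ i)\<^sup>2 + (g y $ j)\<^sup>2) * w y"
      using w by (intro mult_right_mono) auto
    also have "\<dots> = norm (\<bar>f y $ i\<bar>\<^sup>2 * w y + \<bar>g y $ j\<bar>\<^sup>2 * w y)"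
      using w by (simp add: abs_of_nonneg add_nonneg_nonneg algebra_simps)
    finally show "norm (f y $ i * g y $ j * w y) \<le> norm (\<bar>f y $ i\<bar>\<^sup>2 * w y + \<bar>g y $ j\<bar>\<^sup>2 * w y)"
      using w by (simp add: abs_mult)
  qed
qed

lemma wL2_integrable_inner:
  assumes "f \<in> wL2 D w" "g \<in> wL2 D w"
  shows "integrable M (\<lambda>y. (f y \<bullet> g y) * w y)"
  unfolding inner_real4 distrib_right
  by (intro Bochner_Integration.integrable_add wL2_integrable_product assms)

lemma ip_nonneg: "0 \<le> ip f f"
  unfolding ip_def by (rule integral_nonneg_AE) (auto intro!: AE_I2 mult_nonneg_nonneg less_imp_le[OF w_pos])

lemma wnorm_eq: "N f = sqrt (ip f f)"
  by (simp add: wnorm_def ip_def inner_real4 power2_eq_square)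

lemma ip_commute: "ip f g = ip g f"
  by (simp add: ip_def inner_commute)

lemma ip_add:
  assumes "f \<in> wL2 D w" "g \<in> wL2 D w" "h \<in> wL2 D w"
  shows "ip (\<lambda>y. f y + g y) h = ip f h + ip g h"
  unfolding ip_def inner_add_left distrib_right
  by (intro Bochner_Integration.integral_add wL2_integrable_inner assms)

lemma ip_scale: "ip (\<lambda>y. t *\<^sub>R f y) h = t * ip f h"
  by (simp add: ip_def mult.assoc)

lemma wL2_scale: "f \<in> wL2 D w \<Longrightarrow> (\<lambda>y. t *\<^sub>R f y) \<in> wL2 D w"
  by (auto simp: wL2_def abs_mult power_mult_distrib mult.assoc intro!: borel_measurable_times)

lemma wL2_add:
  assumes "f \<in> wL2 D w" "g \<in> wL2 D w"
  shows "(\<lambda>y. f y + g y) \<in> wL2 D w"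
proof -
  have "integrable M (\<lambda>y. \<bar>(f y + g y) $ k\<bar>\<^sup>2 * w y)" for k
  proof -
    have "integrable M (\<lambda>y. f y $ k * f y $ k * w y + 2 * (f y $ k * g y $ k * w y) + g y $ k * g y $ k * w y)"
      using assms by (intro Bochner_Integration.integrable_add integrable_mult_right wL2_integrable_product)
    then show ?thesis by (simp add: power2_eq_square algebra_simps)
  qed
  with assms show ?thesis by (auto simp: wL2_def intro!: borel_measurable_add)
qed

lemma cauchy_schwarz:
  assumes "f \<in> wL2 D w" "g \<in> wL2 D w"
  shows "\<bar>ip f g\<bar> \<le> N f * N g"
  unfolding wnorm_eq
proof (rule quadratic_nonneg_imp_bound[OF _ ip_nonneg])
  fix t
  let ?h = "\<lambda>y. f y + t *\<^sub>R g y"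
  have tg: "(\<lambda>y. t *\<^sub>R g y) \<in> wL2 D w" by (rule wL2_scale[OF assms(2)])
  have expand: "ip ?h k = ip f k + t * ip g k" if "k \<in> wL2 D w" for k
    using ip_add[OF assms(1) tg that] by (simp add: ip_scale)
  have "0 \<le> ip ?h ?h" by (rule ip_nonneg)
  also have "\<dots> = ip f ?h + t * ip g ?h" by (rule expand[OF wL2_add[OF assms(1) tg]])
  also have "\<dots> = ip ?h f + t * ip ?h g" by (simp only: ip_commute)
  also have "\<dots> = (ip f f + t * ip g f) + t * (ip f g + t * ip g g)"
    by (simp only: expand assms)
  also have "ip g f = ip f g" by (rule ip_commute)
  finally show "0 \<le> ip f f + 2 * t * ip f g + t\<^sup>2 * ip g g"
    by (simp add: algebra_simps power2_eq_square)
qed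

lemma X_I:
  assumes "\<And>x. x \<notin> D \<Longrightarrow> f x = 0" "\<And>k. C1_on (\<lambda>y. f y $ k) D" "cimmino_system D \<delta> f" "f \<in> wL2 D w"
  shows "f \<in> X"
  using assms by (auto simp: cimmino_bergman_def wL2_def)

lemma X_zero: "(\<lambda>x. 0) \<in> X"
  by (rule X_I) (auto simp: C1_on_const cimmino_system_iff wL2_def cim_zero)

lemma X_add:
  assumes f: "f \<in> X" and g: "g \<in> X"
  shows "(\<lambda>x. f x + g x) \<in> X"
proof (rule X_I)
  show "cimmino_system D \<delta> (\<lambda>x. f x + g x)"
    unfolding cimmino_system_iff
  proof
    fix x assume x: "x \<in> D"
    have "cim (\<lambda>k j. partial j (\<lambda>y. (f y + g y) $ k) x + \<delta> x $ j * (f x + g x) $ k) =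
        cim (\<lambda>k j. (partial j (\<lambda>y. f y $ k) x + \<delta> x $ j * f x $ k) +
                    (partial j (\<lambda>y. g y $ k) x + \<delta> x $ j * g x $ k))"
      using X_differentiable[OF f x] X_differentiable[OF g x] by (simp add: partial_add algebra_simps)
    also have "\<dots> = 0"
      using X_imp_system[OF f] X_imp_system[OF g] x by (simp add: cim_add cimmino_system_iff)
    finally show "cim (\<lambda>k j. partial j (\<lambda>y. (f y + g y) $ k) x + \<delta> x $ j * (f x + g x) $ k) = 0" .
  qed
  show "(\<lambda>x. f x + g x) \<in> wL2 D w" by (intro wL2_add X_imp_wL2 f g)
qed (use f g in \<open>auto simp: X_outside intro!: C1_on_add X_imp_C1\<close>)

lemma X_scale:
  assumes f: "f \<in> X"
  shows "(\<lambda>x. t *\<^sub>R f x) \<in> X"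
proof (rule X_I)
  show "cimmino_system D \<delta> (\<lambda>x. t *\<^sub>R f x)"
    unfolding cimmino_system_iff
  proof
    fix x assume x: "x \<in> D"
    have "cim (\<lambda>k j. partial j (\<lambda>y. (t *\<^sub>R f y) $ k) x + \<delta> x $ j * (t *\<^sub>R f x) $ k) =
        cim (\<lambda>k j. t * (partial j (\<lambda>y. f y $ k) x + \<delta> x $ j * f x $ k))"
      using X_differentiable[OF f x] by (simp add: partial_cmult algebra_simps)
    also have "\<dots> = 0"
      using X_imp_system[OF f] x by (simp add: cim_scale cimmino_system_iff)
    finally show "cim (\<lambda>k j. partial j (\<lambda>y. (t *\<^sub>R f y) $ k) x + \<delta> x $ j * (t *\<^sub>R f x) $ k) = 0" .
  qed
  show "(\<lambda>x. t *\<^sub>R f x) \<in> wL2 D w" by (intro wL2_scale X_imp_wL2 f)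
qed (use f in \<open>auto simp: X_outside intro!: C1_on_cmult X_imp_C1\<close>)

lemma X_diff: "f \<in> X \<Longrightarrow> g \<in> X \<Longrightarrow> (\<lambda>x. f x - g x) \<in> X"
  using X_add[OF _ X_scale[of g "-1"], of f] by simp

lemma partial_runit:
  assumes "\<And>k. (\<lambda>y. f y $ k) differentiable (at x)"
  shows "partial j (\<lambda>y. runit i (f y) $ k) x = runit i (\<chi> k. partial j (\<lambda>y. f y $ k) x) $ k"
  using index4_cases[of i] index4_cases[of k] assms by (auto simp: runit_def partial_minus)

lemma C1_on_runit:
  assumes "\<And>k. C1_on (\<lambda>y. f y $ k) D"
  shows "C1_on (\<lambda>y. runit i (f y) $ k) D"
  using index4_cases[of i] index4_cases[of k] assms C1_on_minus[OF assms] by (auto simp: runit_def)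

lemma X_runit:
  assumes f: "f \<in> X"
  shows "(\<lambda>x. runit i (f x)) \<in> X"
proof (rule X_I)
  show "cimmino_system D \<delta> (\<lambda>x. runit i (f x))"
    unfolding cimmino_system_iff
  proof
    fix x assume x: "x \<in> D"
    have "cim (\<lambda>k j. partial j (\<lambda>y. runit i (f y) $ k) x + \<delta> x $ j * runit i (f x) $ k) =
        cim (\<lambda>k j. runit i (\<chi> k. partial j (\<lambda>y. f y $ k) x + \<delta> x $ j * f x $ k) $ k)"
    proof -
      have "runit i (\<chi> k. partial j (\<lambda>y. f y $ k) x) $ k + \<delta> x $ j * runit i (f x) $ k =
          runit i (\<chi> k. partial j (\<lambda>y. f y $ k) x + \<delta> x $ j * f x $ k) $ k" for j k
        using index4_cases[of i] index4_cases[of k] by (auto simp: runit_def)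
      then show ?thesis using X_differentiable[OF f x] by (simp add: partial_runit)
    qed
    also have "\<dots> = 0"
      using X_imp_system[OF f] x by (simp add: cim_runit cimmino_system_iff)
    finally show "cim (\<lambda>k j. partial j (\<lambda>y. runit i (f y) $ k) x + \<delta> x $ j * runit i (f x) $ k) = 0" .
  qed
  have "C1_on (\<lambda>y. f y $ k) D" for k using f by (rule X_imp_C1)
  then show "C1_on (\<lambda>y. runit i (f y) $ k) D" for k by (rule C1_on_runit)
  have "\<forall>k. (\<lambda>y. runit i (f y) $ k) \<in> borel_measurable M \<and>
      integrable M (\<lambda>y. \<bar>runit i (f y) $ k\<bar>\<^sup>2 * w y)"
    using index4_cases[of i] X_imp_wL2[OF f] unfolding all_index4 by (auto simp: runit_def wL2_def)
  then show "(\<lambda>x. runit i (f x)) \<in> wL2 D w" by (simp add: wL2_def)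
qed (use index4_cases[of i] f in \<open>auto simp: X_outside runit_def tup4_def vec_eq_iff\<close>)

lemma X_runit_cnj:
  assumes "f \<in> X" shows "(\<lambda>x. runit_cnj i (f x)) \<in> X"
  using X_runit[OF assms, of i] X_scale[OF X_runit[OF assms, of i], of "-1"] assms
  by (cases "i = 0") (simp_all add: runit_cnj_def)

section \<open>Interior estimates in the weighted norm\<close>

text \<open>
  Multiplication by \<open>e\<^sup>\<phi>\<close> absorbs the coefficient, since \<open>\<partial>\<^sub>j (e\<^sup>\<phi> f\<^sub>k) = e\<^sup>\<phi> (\<partial>\<^sub>j f\<^sub>k + \<delta>\<^sub>j f\<^sub>k)\<close>.
\<close>

lemma monogenic_gauge:
  assumes f: "f \<in> X"
  defines "g \<equiv> \<lambda>y. exp (\<phi> y) *\<^sub>R f y"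
  shows "monogenic_on D g"
    and "x \<in> D \<Longrightarrow> partial j (\<lambda>y. g y $ k) x = exp (\<phi> x) * (partial j (\<lambda>y. f y $ k) x + \<delta> x $ j * f x $ k)"
proof -
  have d: "((\<lambda>y. g y $ k) has_derivative
      (\<lambda>h. (exp (\<phi> x) *\<^sub>R (grad (\<lambda>y. f y $ k) x + f x $ k *\<^sub>R \<delta> x)) \<bullet> h)) (at x)" if "x \<in> D" for k x
  proof -
    have "((\<lambda>y. exp (\<phi> y) * f y $ k) has_derivative
      (\<lambda>h. exp (\<phi> x) * (grad (\<lambda>y. f y $ k) x \<bullet> h) + (exp (\<phi> x) * (\<delta> x \<bullet> h)) * f x $ k)) (at x)"
      by (rule has_derivative_mult[OF has_derivative_exp[OF potential[OF that]]
            has_derivative_grad[OF X_differentiable[OF f that]], THEN has_derivative_eq_rhs])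
         (simp add: fun_eq_iff)
    then show ?thesis
      by (simp add: g_def inner_add_left algebra_simps)
  qed
  have p: "partial j (\<lambda>y. g y $ k) x = exp (\<phi> x) * (partial j (\<lambda>y. f y $ k) x + \<delta> x $ j * f x $ k)"
    if "x \<in> D" for x j k
    using has_derivative_partial(2)[OF d[OF that]] by (simp add: grad_def)
  have c_phi: "continuous_on D \<phi>"
    by (intro continuous_at_imp_continuous_on ballI has_derivative_continuous[OF potential])
  have "C1_on (\<lambda>y. g y $ k) D" for k
    unfolding C1_on_grad
  proof
    show "\<forall>x\<in>D. (\<lambda>y. g y $ k) differentiable (at x)"
      using has_derivative_partial(1)[OF d] by blast
    have "continuous_on D (\<lambda>x. exp (\<phi> x) *\<^sub>R (grad (\<lambda>y. f y $ k) x + f x $ k *\<^sub>R \<delta> x))"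
      using X_imp_C1[OF f, of k] C1_on_imp_continuous_on[OF X_imp_C1[OF f, of k]]
      by (intro continuous_on_scaleR continuous_on_exp continuous_on_add c_phi cont_delta)
         (simp_all add: C1_on_grad)
    then show "continuous_on D (grad (\<lambda>y. g y $ k))"
      by (rule continuous_on_eq) (rule has_derivative_partial(3)[OF d, symmetric])
  qed
  moreover have "cimmino_system D (\<lambda>_. 0) g"
    using X_imp_system[OF f] by (simp add: cimmino_system_iff p cim_scale)
  ultimately show "monogenic_on D g" by blast
  show "partial j (\<lambda>y. g y $ k) x = exp (\<phi> x) * (partial j (\<lambda>y. f y $ k) x + \<delta> x $ j * f x $ k)" if "x \<in> D"
    using p[OF that] .
qed

lemma compact_upper_bound:
  assumes "compact K" "K \<subseteq> D" "continuous_on D u"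
  obtains B where "0 \<le> B" "\<And>x. x \<in> K \<Longrightarrow> u x \<le> (B::real)"
proof -
  have "bounded (u ` K)"
    by (intro compact_imp_bounded compact_continuous_image continuous_on_subset[OF assms(3,2)] assms(1))
  then obtain B where B: "\<And>x. x \<in> K \<Longrightarrow> \<bar>u x\<bar> \<le> B" by (auto simp: bounded_iff)
  have "u x \<le> max 0 B" if "x \<in> K" for x using B[OF that] by linarith
  then show ?thesis using that[of "max 0 B"] by simp
qed

text \<open>
  On a compact box \<open>e\<^sup>2\<^sup>\<phi>\<close> is at most a constant times the weight; the rest is the Cauchy-Schwarz
  inequality with the constant function 1.
\<close>

lemma integral_abs_le_wnorm:
  assumes K: "cbox p q \<subseteq> D"
  obtains C where "0 \<le> C"
    and "\<And>f i. f \<in> X \<Longrightarrow> integral (cbox p q) (\<lambda>y. \<bar>(exp (\<phi> y) *\<^sub>R f y) $ i\<bar>) \<le> C * N f"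
proof -
  have c_phi: "continuous_on D \<phi>"
    by (intro continuous_at_imp_continuous_on ballI has_derivative_continuous[OF potential])
  have "continuous_on D (\<lambda>x. exp (2 * \<phi> x) / w x)"
    using w_pos by (intro continuous_intros c_phi cont_w) force
  from compact_upper_bound[OF compact_cbox K this] obtain B
    where B: "0 \<le> B" "\<And>x. x \<in> cbox p q \<Longrightarrow> exp (2 * \<phi> x) / w x \<le> B" by blast
  define V where "V = integral (cbox p q) (\<lambda>_. 1::real)"
  define C where "C = sqrt B * sqrt V"
  have V0: "0 \<le> V" by (simp add: V_def)
  show ?thesis
  proof (rule that[of C])
    show "0 \<le> C" using B(1) V0 by (simp add: C_def)
    fix f i assume f: "f \<in> X"
    let ?g = "\<lambda>y. \<bar>(exp (\<phi> y) *\<^sub>R f y) $ i\<bar>"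
    have cf: "continuous_on (cbox p q) (\<lambda>y. f y $ i)"
      by (rule continuous_on_subset[OF C1_on_imp_continuous_on[OF X_imp_C1[OF f]] K])
    have cg: "continuous_on (cbox p q) ?g"
      unfolding vector_scaleR_component
      by (intro continuous_intros cf continuous_on_subset[OF c_phi K])
    have cw: "continuous_on (cbox p q) w" by (rule continuous_on_subset[OF cont_w K])
    have sq: "integral (cbox p q) (\<lambda>y. (?g y)\<^sup>2) \<le> B * (N f)\<^sup>2"
    proof -
      have "integral (cbox p q) (\<lambda>y. (?g y)\<^sup>2) \<le> integral (cbox p q) (\<lambda>y. B * ((f y $ i)\<^sup>2 * w y))"
      proof (rule integral_le)
        show "(\<lambda>y. (?g y)\<^sup>2) integrable_on cbox p q"
          by (intro integrable_continuous continuous_intros cg)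
        show "(\<lambda>y. B * ((f y $ i)\<^sup>2 * w y)) integrable_on cbox p q"
          by (intro integrable_continuous continuous_intros cf cw)
        fix y assume y: "y \<in> cbox p q"
        then have w: "0 < w y" using w_pos K by blast
        have "exp (2 * \<phi> y) \<le> B * w y" using B(2)[OF y] w by (simp add: divide_le_eq)
        then have "exp (2 * \<phi> y) * (f y $ i)\<^sup>2 \<le> (B * w y) * (f y $ i)\<^sup>2"
          by (rule mult_right_mono) simp
        then show "(?g y)\<^sup>2 \<le> B * ((f y $ i)\<^sup>2 * w y)"
          by (simp add: power_mult_distrib exp_double[symmetric] mult_ac)
      qed
      also have "\<dots> = B * integral (cbox p q) (\<lambda>y. (f y $ i)\<^sup>2 * w y)" by simp
      also have "integral (cbox p q) (\<lambda>y. (f y $ i)\<^sup>2 * w y) \<le> integral D (\<lambda>y. (f y $ i)\<^sup>2 * w y)"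
      proof (rule integral_subset_le[OF K])
        show "(\<lambda>y. (f y $ i)\<^sup>2 * w y) integrable_on cbox p q"
          by (intro integrable_continuous continuous_intros cf cw)
        have "integrable M (\<lambda>y. (f y $ i)\<^sup>2 * w y)" using X_imp_wL2[OF f] by (simp add: wL2_def)
        then show "(\<lambda>y. (f y $ i)\<^sup>2 * w y) integrable_on D"
          using D_lebesgue by (rule integrable_on_lebesgue_on)
      qed (auto intro!: mult_nonneg_nonneg less_imp_le[OF w_pos])
      also have "integral D (\<lambda>y. (f y $ i)\<^sup>2 * w y) = (\<integral>y. (f y $ i)\<^sup>2 * w y \<partial>M)"
        using X_imp_wL2[OF f] by (intro lebesgue_integral_eq_integral[symmetric] D_lebesgue) (simp add: wL2_def)
      also have "\<dots> \<le> ip f f"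
        unfolding ip_def
      proof (rule integral_mono)
        show "integrable M (\<lambda>y. (f y $ i)\<^sup>2 * w y)" using X_imp_wL2[OF f] by (simp add: wL2_def)
        show "integrable M (\<lambda>y. (f y \<bullet> f y) * w y)" by (intro wL2_integrable_inner X_imp_wL2 f)
        fix y assume "y \<in> space M"
        then have "0 < w y" using w_pos by simp
        moreover have "(f y $ i)\<^sup>2 \<le> f y \<bullet> f y"
          using component_le_norm_cart[of "f y" i] by (simp add: dot_square_norm abs_le_square_iff[symmetric])
        ultimately show "(f y $ i)\<^sup>2 * w y \<le> (f y \<bullet> f y) * w y" by simp
      qed
      finally show ?thesis using B(1) ip_nonneg by (simp add: wnorm_eq mult_left_mono)
    qed
    have "0 \<le> integral (cbox p q) (\<lambda>y. (?g y)\<^sup>2) + 2 * t * integral (cbox p q) ?g + t\<^sup>2 * V" for t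
    proof -
      have i: "(\<lambda>y. (?g y)\<^sup>2) integrable_on cbox p q" "?g integrable_on cbox p q"
        "(\<lambda>_. 1::real) integrable_on cbox p q"
        by (intro integrable_continuous continuous_intros cg)+
      have "((\<lambda>y. (?g y)\<^sup>2 + (2 * t) * ?g y + t\<^sup>2 * 1) has_integral
          (integral (cbox p q) (\<lambda>y. (?g y)\<^sup>2) + (2 * t) * integral (cbox p q) ?g + t\<^sup>2 * V)) (cbox p q)"
        unfolding V_def by (intro has_integral_add has_integral_mult_right integrable_integral i)
      moreover have "0 \<le> (?g y)\<^sup>2 + (2 * t) * ?g y + t\<^sup>2 * 1" for y
      proof -
        have "0 \<le> (?g y + t)\<^sup>2" by simp
        then show ?thesis by (simp only: power2_sum mult_1_right mult.assoc add_ac mult.commute[of t])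
      qed
      ultimately show ?thesis by (rule has_integral_nonneg)
    qed
    from quadratic_nonneg_imp_bound[OF this V0]
    have "integral (cbox p q) ?g \<le> sqrt (integral (cbox p q) (\<lambda>y. (?g y)\<^sup>2)) * sqrt V" by linarith
    also have "\<dots> \<le> sqrt (B * (N f)\<^sup>2) * sqrt V"
      using sq V0 by (intro mult_right_mono real_sqrt_le_mono) auto
    also have "\<dots> = C * N f"
      using ip_nonneg[of f] by (simp add: C_def real_sqrt_mult wnorm_eq)
    finally show "integral (cbox p q) ?g \<le> C * N f" .
  qed
qed

text \<open>
  This is why convergence in norm controls values and first derivatives locally uniformly. The
  derivatives of \<open>f\<close> are recovered from \<open>e\<^sup>-\<^sup>\<phi> \<partial>\<^sub>j g = \<partial>\<^sub>j f + \<delta>\<^sub>j f\<close>.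
\<close>

lemma local_bound:
  assumes x0: "x0 \<in> D"
  obtains R C where "0 < R" "ball x0 R \<subseteq> D" "0 \<le> C"
    and "\<And>f i x. f \<in> X \<Longrightarrow> x \<in> ball x0 R \<Longrightarrow> \<bar>f x $ i\<bar> \<le> C * N f"
    and "\<And>f i j x. f \<in> X \<Longrightarrow> x \<in> ball x0 R \<Longrightarrow> \<bar>partial j (\<lambda>y. f y $ i) x\<bar> \<le> C * N f"
proof -
  obtain p q where pq: "x0 \<in> box p q" "cbox p q \<subseteq> D"
    using open_contains_cbox[of D] open_D x0 by metis
  obtain e where e: "0 < e" "cball x0 e \<subseteq> box p q"
    using pq(1) open_contains_cball open_box by blast
  define R where "R = e / 2"
  have R: "0 < R" "cball x0 (2 * R) \<subseteq> cbox p q"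
    using e box_subset_cbox[of p q] by (auto simp: R_def)
  have sub: "ball x0 R \<subseteq> cbox p q"
    using R by (auto simp: subset_iff)
  obtain C where C: "0 \<le> C"
    and C1: "\<And>g i x. monogenic_on D g \<Longrightarrow> x \<in> ball x0 R \<Longrightarrow>
      \<bar>g x $ i\<bar> \<le> C * integral (cbox p q) (\<lambda>y. \<bar>g y $ i\<bar>)"
    and C2: "\<And>g i j x. monogenic_on D g \<Longrightarrow> x \<in> ball x0 R \<Longrightarrow>
      \<bar>partial j (\<lambda>y. g y $ i) x\<bar> \<le> C * integral (cbox p q) (\<lambda>y. \<bar>g y $ i\<bar>)"
    using monogenic_local_estimate[OF open_D R pq(2)] by blast
  obtain L where L: "0 \<le> L"
    and L1: "\<And>f i. f \<in> X \<Longrightarrow> integral (cbox p q) (\<lambda>y. \<bar>(exp (\<phi> y) *\<^sub>R f y) $ i\<bar>) \<le> L * N f"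
    using integral_abs_le_wnorm[OF pq(2)] by blast
  have "continuous_on D (\<lambda>x. exp (- \<phi> x))"
    by (intro continuous_intros continuous_at_imp_continuous_on ballI has_derivative_continuous[OF potential])
  from compact_upper_bound[OF compact_cbox pq(2) this] obtain A
    where A: "0 \<le> A" "\<And>x. x \<in> cbox p q \<Longrightarrow> exp (- \<phi> x) \<le> A" by blast
  have "continuous_on D (\<lambda>x. norm (\<delta> x))" by (intro continuous_intros cont_delta)
  from compact_upper_bound[OF compact_cbox pq(2) this] obtain E
    where E: "0 \<le> E" "\<And>x. x \<in> cbox p q \<Longrightarrow> norm (\<delta> x) \<le> E" by blast
  have N0: "0 \<le> N f" for f by (simp add: wnorm_eq ip_nonneg)
  define B where "B = A * (C * L)"
  have B0: "0 \<le> B" using A C L by (simp add: B_def)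
  have main: "\<bar>f x $ i\<bar> \<le> B * N f" "\<bar>partial j (\<lambda>y. f y $ i) x\<bar> \<le> (B + E * B) * N f"
    if f: "f \<in> X" and x: "x \<in> ball x0 R" for f i j x
  proof -
    let ?g = "\<lambda>y. exp (\<phi> y) *\<^sub>R f y"
    have xK: "x \<in> cbox p q" "x \<in> D" using x sub pq(2) by auto
    have I: "C * integral (cbox p q) (\<lambda>y. \<bar>?g y $ i\<bar>) \<le> C * (L * N f)"
      by (intro mult_left_mono L1 f C)
    have ungauge: "\<bar>u\<bar> \<le> B * N f" if "\<bar>exp (\<phi> x) * u\<bar> \<le> C * (L * N f)" for u
    proof -
      have "\<bar>u\<bar> = exp (- \<phi> x) * \<bar>exp (\<phi> x) * u\<bar>"
        by (simp add: abs_mult exp_minus)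
      also have "\<dots> \<le> A * (C * (L * N f))"
        using that A(1) A(2)[OF xK(1)] by (intro mult_mono) auto
      finally show ?thesis by (simp add: B_def mult_ac)
    qed
    show fx: "\<bar>f x $ i\<bar> \<le> B * N f"
      using C1[OF monogenic_gauge(1)[OF f] x, of i] I by (intro ungauge) simp
    have "\<bar>partial j (\<lambda>y. f y $ i) x + \<delta> x $ j * f x $ i\<bar> \<le> B * N f"
      using C2[OF monogenic_gauge(1)[OF f] x, of j i] I monogenic_gauge(2)[OF f xK(2), of j i]
      by (intro ungauge) simp
    moreover have "\<bar>\<delta> x $ j * f x $ i\<bar> \<le> E * (B * N f)"
      unfolding abs_mult using fx E(1) E(2)[OF xK(1)] component_le_norm_cart[of "\<delta> x" j]
      by (intro mult_mono) auto
    ultimately show "\<bar>partial j (\<lambda>y. f y $ i) x\<bar> \<le> (B + E * B) * N f"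
      by (simp add: algebra_simps)
  qed
  show ?thesis
  proof (rule that[of R "B + E * B"])
    show "0 < R" "ball x0 R \<subseteq> D" "0 \<le> B + E * B" using R sub pq(2) B0 E by auto
    show "\<bar>f x $ i\<bar> \<le> (B + E * B) * N f" if "f \<in> X" "x \<in> ball x0 R" for f i x
    proof -
      have "B * N f \<le> (B + E * B) * N f" using B0 E(1) N0 by (intro mult_right_mono) auto
      then show ?thesis using main(1)[OF that, of i] by linarith
    qed
    show "\<bar>partial j (\<lambda>y. f y $ i) x\<bar> \<le> (B + E * B) * N f" if "f \<in> X" "x \<in> ball x0 R" for f i j x
      using main(2)[OF that] .
  qed
qed

section \<open>Completeness\<close>

lemma wL2_I_norm:
  assumes "\<And>k. (\<lambda>y. f y $ k) \<in> borel_measurable M" and int: "integrable M (\<lambda>y. (f y \<bullet> f y) * w y)"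
  shows "f \<in> wL2 D w"
proof -
  have "integrable M (\<lambda>y. \<bar>f y $ k\<bar>\<^sup>2 * w y)" for k
  proof (rule Bochner_Integration.integrable_bound[OF int])
    show "(\<lambda>y. \<bar>f y $ k\<bar>\<^sup>2 * w y) \<in> borel_measurable M"
      using assms(1)[of k] w_measurable by measurable
    show "AE y in M. norm (\<bar>f y $ k\<bar>\<^sup>2 * w y) \<le> norm ((f y \<bullet> f y) * w y)"
    proof (rule AE_I2)
      fix y assume "y \<in> space M"
      then have "0 < w y" using w_pos by simp
      moreover have "(f y $ k)\<^sup>2 \<le> f y \<bullet> f y"
        using component_le_norm_cart[of "f y" k] by (simp add: dot_square_norm abs_le_square_iff[symmetric])
      ultimately show "norm (\<bar>f y $ k\<bar>\<^sup>2 * w y) \<le> norm ((f y \<bullet> f y) * w y)"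
        by (simp add: abs_mult mult_right_mono)
    qed
  qed
  with assms(1) show ?thesis by (simp add: wL2_def)
qed

lemma partial_diff_X:
  assumes "f \<in> X" "g \<in> X" "x \<in> D"
  shows "partial j (\<lambda>y. (f y - g y) $ i) x = partial j (\<lambda>y. f y $ i) x - partial j (\<lambda>y. g y $ i) x"
  using partial_add[OF X_differentiable[OF assms(1,3), of i]
      X_differentiable[OF X_scale[OF assms(2), of "-1"] assms(3), of i], of j]
    partial_minus[OF X_differentiable[OF assms(2,3), of i], of j] by simp

context
  fixes u :: "nat \<Rightarrow> real^4 \<Rightarrow> real^4"
  assumes uX: "\<And>n. u n \<in> X"
    and cauchy: "\<And>e. 0 < e \<Longrightarrow> \<exists>m. \<forall>k\<ge>m. \<forall>n\<ge>m. N (\<lambda>x. u k x - u n x) < e"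
begin

definition f_lim :: "real^4 \<Rightarrow> real^4"
  where "f_lim x = (if x \<in> D then \<chi> i. lim (\<lambda>n. u n x $ i) else 0)"

definition p_lim :: "4 \<Rightarrow> 4 \<Rightarrow> real^4 \<Rightarrow> real"
  where "p_lim i j x = lim (\<lambda>n. partial j (\<lambda>y. u n y $ i) x)"

lemma locally_uniform_convergence:
  assumes "x0 \<in> D"
  obtains R where "0 < R" "ball x0 R \<subseteq> D"
    and "\<And>i. uniform_limit (ball x0 R) (\<lambda>n x. u n x $ i) (\<lambda>x. f_lim x $ i) sequentially"
    and "\<And>i j. uniform_limit (ball x0 R) (\<lambda>n. partial j (\<lambda>y. u n y $ i)) (p_lim i j) sequentially"
proof -
  obtain R C where R: "0 < R" "ball x0 R \<subseteq> D" and C: "0 \<le> C"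
    and b1: "\<And>f i x. f \<in> X \<Longrightarrow> x \<in> ball x0 R \<Longrightarrow> \<bar>f x $ i\<bar> \<le> C * N f"
    and b2: "\<And>f i j x. f \<in> X \<Longrightarrow> x \<in> ball x0 R \<Longrightarrow> \<bar>partial j (\<lambda>y. f y $ i) x\<bar> \<le> C * N f"
    using local_bound[OF assms] by blast
  have small: "\<exists>m. \<forall>k\<ge>m. \<forall>n\<ge>m. C * N (\<lambda>x. u k x - u n x) < e" if "0 < e" for e
  proof -
    have "0 < e / (C + 1)" using that C by simp
    from cauchy[OF this] obtain m where m: "\<forall>k\<ge>m. \<forall>n\<ge>m. N (\<lambda>x. u k x - u n x) < e / (C + 1)"
      by blast
    have "C * N (\<lambda>x. u k x - u n x) < e" if "k \<ge> m" "n \<ge> m" for k n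
    proof -
      have "C * N (\<lambda>x. u k x - u n x) \<le> C * (e / (C + 1))"
        using m that C by (intro mult_left_mono) (auto intro: less_imp_le)
      also have "\<dots> < e" using C \<open>0 < e\<close> by (simp add: field_simps)
      finally show ?thesis .
    qed
    then show ?thesis by blast
  qed
  \<comment> \<open>Applied below to the values and to the partial derivatives of the sequence.\<close>
  have uniform: "uniform_limit (ball x0 R) v (\<lambda>x. lim (\<lambda>n. v n x)) sequentially"
    if v: "\<And>k n x. x \<in> ball x0 R \<Longrightarrow> \<bar>v k x - v n x\<bar> \<le> C * N (\<lambda>x. u k x - u n x)"
    for v :: "nat \<Rightarrow> real^4 \<Rightarrow> real"
  proof -
    have "uniformly_Cauchy_on (ball x0 R) v"
      unfolding uniformly_Cauchy_on_def
    proof (intro allI impI)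
      fix e :: real assume "0 < e"
      then obtain m where "\<forall>k\<ge>m. \<forall>n\<ge>m. C * N (\<lambda>x. u k x - u n x) < e" using small by blast
      then show "\<exists>m. \<forall>x\<in>ball x0 R. \<forall>k\<ge>m. \<forall>n\<ge>m. dist (v k x) (v n x) < e"
        unfolding dist_real_def using v by (meson le_less_trans)
    qed
    then show ?thesis
      unfolding uniformly_convergent_uniform_limit_iff[symmetric] by (rule Cauchy_uniformly_convergent)
  qed
  show ?thesis
  proof (rule that[OF R])
    show "uniform_limit (ball x0 R) (\<lambda>n. partial j (\<lambda>y. u n y $ i)) (p_lim i j) sequentially" for i j
      unfolding p_lim_def[abs_def]
    proof (rule uniform)
      fix k n x assume x: "x \<in> ball x0 R"
      then have "x \<in> D" using R by blast
      then show "\<bar>partial j (\<lambda>y. u k y $ i) x - partial j (\<lambda>y. u n y $ i) x\<bar> \<le> C * N (\<lambda>x. u k x - u n x)"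
        using b2[OF X_diff[OF uX uX] x, of j k n i] by (simp only: partial_diff_X[OF uX uX])
    qed
    show "uniform_limit (ball x0 R) (\<lambda>n x. u n x $ i) (\<lambda>x. f_lim x $ i) sequentially" for i
    proof (rule uniform_limit_cong'[THEN iffD1, OF _ _ uniform[of "\<lambda>n x. u n x $ i"]])
      show "lim (\<lambda>n. u n x $ i) = f_lim x $ i" if "x \<in> ball x0 R" for x
        using that R by (auto simp: f_lim_def)
      show "\<bar>u k x $ i - u n x $ i\<bar> \<le> C * N (\<lambda>x. u k x - u n x)" if "x \<in> ball x0 R" for k n x
        using b1[OF X_diff[OF uX uX] that] by simp
    qed simp
  qed
qed

lemma f_lim_limits:
  assumes "x \<in> D"
  shows "(\<lambda>n. u n x $ i) \<longlonglongrightarrow> f_lim x $ i" and "(\<lambda>n. partial j (\<lambda>y. u n y $ i) x) \<longlonglongrightarrow> p_lim i j x"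
proof -
  obtain R where R: "0 < R"
    and "ball x R \<subseteq> D"
    and u: "\<And>i. uniform_limit (ball x R) (\<lambda>n x. u n x $ i) (\<lambda>x. f_lim x $ i) sequentially"
    and p: "\<And>i j. uniform_limit (ball x R) (\<lambda>n. partial j (\<lambda>y. u n y $ i)) (p_lim i j) sequentially"
    by (rule locally_uniform_convergence[OF assms]) (rule that)
  have x: "x \<in> ball x R" using R by simp
  show "(\<lambda>n. u n x $ i) \<longlonglongrightarrow> f_lim x $ i" by (rule tendsto_uniform_limitI[OF u x])
  show "(\<lambda>n. partial j (\<lambda>y. u n y $ i) x) \<longlonglongrightarrow> p_lim i j x" by (rule tendsto_uniform_limitI[OF p x])
qed

text \<open>
  The partial derivatives converge uniformly near each point, so the limit may be differentiated term
  by term.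
\<close>

lemma f_lim_has_derivative:
  assumes x0: "x0 \<in> D"
  shows "((\<lambda>y. f_lim y $ i) has_derivative (\<lambda>h. (\<chi> j. p_lim i j x0) \<bullet> h)) (at x0)"
proof -
  obtain R where R: "0 < R" "ball x0 R \<subseteq> D"
    and "\<And>i. uniform_limit (ball x0 R) (\<lambda>n x. u n x $ i) (\<lambda>x. f_lim x $ i) sequentially"
    and unif: "\<And>i j. uniform_limit (ball x0 R) (\<lambda>n. partial j (\<lambda>y. u n y $ i)) (p_lim i j) sequentially"
    by (rule locally_uniform_convergence[OF x0]) (rule that)
  have at: "at x within ball x0 R = at x" if "x \<in> ball x0 R" for x
    using that by (intro at_within_open) auto
  have "\<exists>g. \<forall>x\<in>ball x0 R. (\<lambda>n. u n x $ i) \<longlonglongrightarrow> g x \<and>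
      (g has_derivative (\<lambda>h. (\<chi> j. p_lim i j x) \<bullet> h)) (at x within ball x0 R)"
  proof (rule has_derivative_sequence)
    show "convex (ball x0 R)" "x0 \<in> ball x0 R" using R by auto
    show "(\<lambda>n. u n x0 $ i) \<longlonglongrightarrow> f_lim x0 $ i" by (rule f_lim_limits(1)[OF x0])
    show "((\<lambda>x. u n x $ i) has_derivative (\<lambda>h. grad (\<lambda>x. u n x $ i) x \<bullet> h)) (at x within ball x0 R)"
      if "x \<in> ball x0 R" for n x
      unfolding at[OF that] using that R by (intro has_derivative_grad X_differentiable uX) auto
    fix e :: real assume "0 < e"
    then have "0 < e / 4" by simp
    then have "\<forall>\<^sub>F n in sequentially. \<forall>x\<in>ball x0 R. dist (partial j (\<lambda>y. u n y $ i) x) (p_lim i j x) < e / 4" for j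
      by (rule uniform_limitD[OF unif])
    then have "\<forall>\<^sub>F n in sequentially. \<forall>j. \<forall>x\<in>ball x0 R. dist (partial j (\<lambda>y. u n y $ i) x) (p_lim i j x) < e / 4"
      by (rule eventually_all_finite)
    then show "\<forall>\<^sub>F n in sequentially. \<forall>x\<in>ball x0 R. \<forall>h.
        norm (grad (\<lambda>x. u n x $ i) x \<bullet> h - (\<chi> j. p_lim i j x) \<bullet> h) \<le> e * norm h"
    proof (eventually_elim, intro ballI allI)
      fix n and x h :: "real^4"
      assume "\<forall>j. \<forall>x\<in>ball x0 R. dist (partial j (\<lambda>y. u n y $ i) x) (p_lim i j x) < e / 4" and "x \<in> ball x0 R"
      then have "\<bar>(grad (\<lambda>x. u n x $ i) x - (\<chi> j. p_lim i j x)) $ j\<bar> \<le> e / 4" for j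
        unfolding vector_minus_component grad_def vec_lambda_beta dist_real_def by (meson less_imp_le)
      then have "(\<Sum>j\<in>UNIV. \<bar>(grad (\<lambda>x. u n x $ i) x - (\<chi> j. p_lim i j x)) $ j\<bar>) \<le> (\<Sum>j\<in>(UNIV::4 set). e / 4)"
        by (intro sum_mono) blast
      then have "norm (grad (\<lambda>x. u n x $ i) x - (\<chi> j. p_lim i j x)) \<le> e"
        using norm_le_l1_cart[of "grad (\<lambda>x. u n x $ i) x - (\<chi> j. p_lim i j x)"] by simp
      then have "norm (grad (\<lambda>x. u n x $ i) x - (\<chi> j. p_lim i j x)) * norm h \<le> e * norm h"
        by (rule mult_right_mono) simp
      then show "norm (grad (\<lambda>x. u n x $ i) x \<bullet> h - (\<chi> j. p_lim i j x) \<bullet> h) \<le> e * norm h"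
        using Cauchy_Schwarz_ineq2[of "grad (\<lambda>x. u n x $ i) x - (\<chi> j. p_lim i j x)" h]
        by (simp add: inner_diff_left)
    qed
  qed
  then obtain g where *: "\<forall>x\<in>ball x0 R. (\<lambda>n. u n x $ i) \<longlonglongrightarrow> g x \<and>
      (g has_derivative (\<lambda>h. (\<chi> j. p_lim i j x) \<bullet> h)) (at x within ball x0 R)" by (rule exE)
  have x0R: "x0 \<in> ball x0 R" using R by simp
  have g: "(\<lambda>n. u n x $ i) \<longlonglongrightarrow> g x" if "x \<in> ball x0 R" for x
    using * that by blast
  have dg: "(g has_derivative (\<lambda>h. (\<chi> j. p_lim i j x0) \<bullet> h)) (at x0)"
    using bspec[OF * x0R] at[OF x0R] by simp
  show ?thesis
  proof (rule has_derivative_transform_within_open[OF dg open_ball x0R])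
    show "g x = f_lim x $ i" if "x \<in> ball x0 R" for x
      using g[OF that] f_lim_limits(1)[of x i] that R LIMSEQ_unique by blast
  qed
qed

lemma f_lim_partial: "x \<in> D \<Longrightarrow> partial j (\<lambda>y. f_lim y $ i) x = p_lim i j x"
  using has_derivative_partial(2)[OF f_lim_has_derivative] by simp

lemma f_lim_C1: "C1_on (\<lambda>y. f_lim y $ i) D"
  unfolding C1_on_def
proof (intro conjI ballI allI)
  show "(\<lambda>y. f_lim y $ i) differentiable (at x)" if "x \<in> D" for x
    by (rule has_derivative_partial(1)[OF f_lim_has_derivative[OF that]])
  fix j
  have "isCont (p_lim i j) x0" if x0: "x0 \<in> D" for x0
  proof -
    obtain R where R: "0 < R" "ball x0 R \<subseteq> D"
      and "\<And>i. uniform_limit (ball x0 R) (\<lambda>n x. u n x $ i) (\<lambda>x. f_lim x $ i) sequentially"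
    and unif: "\<And>i j. uniform_limit (ball x0 R) (\<lambda>n. partial j (\<lambda>y. u n y $ i)) (p_lim i j) sequentially"
      by (rule locally_uniform_convergence[OF x0]) (rule that)
    have "continuous_on (ball x0 R) (p_lim i j)"
    proof (rule uniform_limit_theorem[OF _ unif])
      show "\<forall>\<^sub>F n in sequentially. continuous_on (ball x0 R) (partial j (\<lambda>y. u n y $ i))"
        using X_imp_C1[OF uX] R(2) continuous_on_subset unfolding C1_on_def
        by (intro always_eventually allI) blast
    qed simp
    then show ?thesis using R by (simp add: continuous_on_eq_continuous_at)
  qed
  then have "continuous_on D (p_lim i j)" by (intro continuous_at_imp_continuous_on) blast
  then show "continuous_on D (partial j (\<lambda>y. f_lim y $ i))"
    by (rule continuous_on_eq) (simp add: f_lim_partial)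
qed

lemma f_lim_system: "cimmino_system D \<delta> f_lim"
  unfolding cimmino_system_iff
proof
  fix x assume x: "x \<in> D"
  have "(\<lambda>n. partial j (\<lambda>y. u n y $ k) x + \<delta> x $ j * u n x $ k) \<longlonglongrightarrow>
      partial j (\<lambda>y. f_lim y $ k) x + \<delta> x $ j * f_lim x $ k" for k j
    unfolding f_lim_partial[OF x] by (intro tendsto_intros f_lim_limits x)
  then have "(\<lambda>n. cim (\<lambda>k j. partial j (\<lambda>y. u n y $ k) x + \<delta> x $ j * u n x $ k)) \<longlonglongrightarrow>
      cim (\<lambda>k j. partial j (\<lambda>y. f_lim y $ k) x + \<delta> x $ j * f_lim x $ k)"
    by (rule tendsto_cim)
  moreover have "cim (\<lambda>k j. partial j (\<lambda>y. u n y $ k) x + \<delta> x $ j * u n x $ k) = 0" for n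
    using X_imp_system[OF uX] x by (simp add: cimmino_system_iff)
  ultimately show "cim (\<lambda>k j. partial j (\<lambda>y. f_lim y $ k) x + \<delta> x $ j * f_lim x $ k) = 0"
    by (simp add: LIMSEQ_const_iff)
qed

text \<open>
  Fatou's lemma applied to \<open>\<bar>u\<^sub>n - u\<^sub>m\<bar>\<^sup>2 w\<close> as \<open>m\<close> tends to infinity. It yields both the
  square-integrability of \<open>u\<^sub>n\<close> minus the limit and the bound on its norm.
\<close>

lemma f_lim_fatou:
  assumes e: "0 < e" and close: "\<And>m. m \<ge> m0 \<Longrightarrow> N (\<lambda>x. u n x - u m x) \<le> e"
  shows "(\<lambda>x. u n x - f_lim x) \<in> wL2 D w" and "N (\<lambda>x. u n x - f_lim x) \<le> e"
proof -
  let ?d = "\<lambda>y. u n y - f_lim y" and ?dm = "\<lambda>m y. u n y - u m y"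
  have meas: "(\<lambda>y. ?d y $ k) \<in> borel_measurable M" for k
    unfolding vector_minus_component
    by (intro measurable_continuous continuous_on_diff C1_on_imp_continuous_on f_lim_C1 X_imp_C1 uX)
  have sq_meas: "(\<lambda>y. (?d y \<bullet> ?d y) * w y) \<in> borel_measurable M"
    unfolding inner_real4 by (intro borel_measurable_times borel_measurable_add meas w_measurable)
  have pos: "0 \<le> (v \<bullet> v) * w y" if "y \<in> D" for v :: "real^4" and y
    using w_pos[OF that] by simp
  have dX: "?dm m \<in> X" for m by (intro X_diff uX)
  have int: "integrable M (\<lambda>y. (?dm m y \<bullet> ?dm m y) * w y)" for m
    by (intro wL2_integrable_inner X_imp_wL2 dX)
  have eq: "(\<integral>\<^sup>+ y. ennreal ((?dm m y \<bullet> ?dm m y) * w y) \<partial>M) = ennreal ((N (?dm m))\<^sup>2)" for m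
    using pos ip_nonneg[of "?dm m"] by (subst nn_integral_eq_integral[OF int]) (auto intro!: AE_I2 simp: wnorm_eq ip_def)
  have "(\<integral>\<^sup>+ y. ennreal ((?d y \<bullet> ?d y) * w y) \<partial>M) =
      (\<integral>\<^sup>+ y. liminf (\<lambda>m. ennreal ((?dm m y \<bullet> ?dm m y) * w y)) \<partial>M)"
  proof (rule nn_integral_cong)
    fix y assume "y \<in> space M"
    then have y: "y \<in> D" by simp
    have "(\<lambda>m. (?dm m y \<bullet> ?dm m y) * w y) \<longlonglongrightarrow> (?d y \<bullet> ?d y) * w y"
      unfolding inner_real4 vector_minus_component by (intro tendsto_intros f_lim_limits y)
    then have "(\<lambda>m. ennreal ((?dm m y \<bullet> ?dm m y) * w y)) \<longlonglongrightarrow> ennreal ((?d y \<bullet> ?d y) * w y)"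
      by (rule tendsto_ennrealI)
    then show "ennreal ((?d y \<bullet> ?d y) * w y) = liminf (\<lambda>m. ennreal ((?dm m y \<bullet> ?dm m y) * w y))"
      by (intro lim_imp_Liminf[symmetric]) simp_all
  qed
  also have "\<dots> \<le> liminf (\<lambda>m. \<integral>\<^sup>+ y. ennreal ((?dm m y \<bullet> ?dm m y) * w y) \<partial>M)"
    using int by (intro nn_integral_liminf) (auto intro: borel_measurable_integrable)
  also have "\<dots> \<le> ennreal (e\<^sup>2)"
    unfolding eq
  proof (rule Liminf_le)
    show "\<forall>\<^sub>F m in sequentially. ennreal ((N (?dm m))\<^sup>2) \<le> ennreal (e\<^sup>2)"
      using close ip_nonneg unfolding eventually_sequentially
      by (intro exI[of _ m0] allI impI ennreal_leI power_mono) (auto simp: wnorm_eq)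
  qed simp
  finally have le: "(\<integral>\<^sup>+ y. ennreal ((?d y \<bullet> ?d y) * w y) \<partial>M) \<le> ennreal (e\<^sup>2)" .
  have intd: "integrable M (\<lambda>y. (?d y \<bullet> ?d y) * w y)"
    using le pos by (intro integrableI_nonneg sq_meas) (auto intro!: AE_I2 intro: le_less_trans)
  show "?d \<in> wL2 D w" by (rule wL2_I_norm[OF meas intd])
  have "ennreal (ip ?d ?d) \<le> ennreal (e\<^sup>2)"
    using le nn_integral_eq_integral[OF intd AE_I2[OF pos]] unfolding ip_def by simp
  then have "ip ?d ?d \<le> e\<^sup>2" by simp
  then show "N ?d \<le> e" using e unfolding wnorm_eq by (intro real_le_lsqrt) auto
qed

lemma complete: "\<exists>f\<in>X. (\<lambda>n. N (\<lambda>x. u n x - f x)) \<longlonglongrightarrow> 0"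
proof
  have close: "\<exists>m. \<forall>n\<ge>m. (\<lambda>x. u n x - f_lim x) \<in> wL2 D w \<and> N (\<lambda>x. u n x - f_lim x) \<le> e" if e: "0 < e" for e
  proof -
    obtain m where m: "\<forall>k\<ge>m. \<forall>n\<ge>m. N (\<lambda>x. u k x - u n x) < e" using cauchy[OF e] by blast
    then have "(\<lambda>x. u n x - f_lim x) \<in> wL2 D w \<and> N (\<lambda>x. u n x - f_lim x) \<le> e" if "n \<ge> m" for n
      using f_lim_fatou[OF e, of m n] that by (auto intro: less_imp_le)
    then show ?thesis by blast
  qed
  obtain n where n: "(\<lambda>x. u n x - f_lim x) \<in> wL2 D w" using close[OF zero_less_one] by blast
  show "f_lim \<in> X"
  proof (rule X_I[OF _ f_lim_C1 f_lim_system])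
    show "f_lim x = 0" if "x \<notin> D" for x using that by (simp add: f_lim_def)
    show "f_lim \<in> wL2 D w"
      using wL2_add[OF X_imp_wL2[OF uX] wL2_scale[OF n, of "-1"], of n] by simp
  qed
  show "(\<lambda>n. N (\<lambda>x. u n x - f_lim x)) \<longlonglongrightarrow> 0"
  proof (rule LIMSEQ_I)
    fix e :: real assume "0 < e"
    then obtain m where m: "\<forall>n\<ge>m. N (\<lambda>x. u n x - f_lim x) \<le> e / 2" using close[of "e / 2"] by auto
    have "norm (N (\<lambda>x. u n x - f_lim x) - 0) < e" if "n \<ge> m" for n
      using m that \<open>0 < e\<close> by (force simp: wnorm_eq ip_nonneg)
    then show "\<exists>m. \<forall>n\<ge>m. norm (N (\<lambda>x. u n x - f_lim x) - 0) < e" by blast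
  qed
qed

end

section \<open>The Banach space and its reproducing kernel\<close>

lemma wnorm_square: "(N f)\<^sup>2 = ip f f"
  using ip_nonneg[of f] by (simp add: wnorm_eq)

theorem banach: "real_banach_space X N"
  unfolding real_banach_space_def
proof (intro conjI ballI allI impI)
  show "(\<lambda>x. 0) \<in> X" by (rule X_zero)
  show "(\<lambda>x. f x + g x) \<in> X" if "f \<in> X" "g \<in> X" for f g using that by (rule X_add)
  show "(\<lambda>x. t *\<^sub>R f x) \<in> X" if "f \<in> X" for t f using that by (rule X_scale)
  show "0 \<le> N f" for f by (simp add: wnorm_eq ip_nonneg)
  show "N f = 0 \<longleftrightarrow> f = (\<lambda>x. 0)" if f: "f \<in> X" for f
  proof
    assume 0: "N f = 0"
    show "f = (\<lambda>x. 0)"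
    proof
      fix x
      show "f x = 0"
      proof (cases "x \<in> D")
        case True
        then obtain R C where R: "0 < R" and "ball x R \<subseteq> D" "0 \<le> C"
          and b: "\<And>f i y. f \<in> X \<Longrightarrow> y \<in> ball x R \<Longrightarrow> \<bar>f y $ i\<bar> \<le> C * N f"
          and "\<And>f i j y. f \<in> X \<Longrightarrow> y \<in> ball x R \<Longrightarrow> \<bar>partial j (\<lambda>y. f y $ i) y\<bar> \<le> C * N f"
          by (rule local_bound) (rule that)
        then show ?thesis using b[OF f, of x] 0 by (simp add: vec_eq_iff)
      qed (simp add: X_outside[OF f])
    qed
  qed (simp add: wnorm_eq ip_def)
  show "N (\<lambda>x. t *\<^sub>R f x) = \<bar>t\<bar> * N f" if "f \<in> X" for t f
  proof -
    have "ip (\<lambda>x. t *\<^sub>R f x) (\<lambda>x. t *\<^sub>R f x) = t\<^sup>2 * ip f f"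
      unfolding ip_scale ip_commute[of f "\<lambda>x. t *\<^sub>R f x"] by (simp add: power2_eq_square)
    then show ?thesis by (simp add: wnorm_eq real_sqrt_mult)
  qed
  show "N (\<lambda>x. f x + g x) \<le> N f + N g" if "f \<in> X" "g \<in> X" for f g
  proof -
    let ?h = "\<lambda>x. f x + g x"
    note L = X_imp_wL2[OF that(1)] X_imp_wL2[OF that(2)]
    have expand: "ip ?h k = ip f k + ip g k" if "k \<in> wL2 D w" for k by (rule ip_add[OF L that])
    have "ip ?h ?h = ip f ?h + ip g ?h" by (rule expand[OF wL2_add[OF L]])
    also have "\<dots> = ip ?h f + ip ?h g" by (simp only: ip_commute)
    also have "\<dots> = (ip f f + ip g f) + (ip f g + ip g g)" by (simp only: expand L)
    also have "ip g f = ip f g" by (rule ip_commute)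
    finally have "ip ?h ?h \<le> (N f + N g)\<^sup>2"
      using cauchy_schwarz[OF L] by (simp add: power2_sum wnorm_square)
    then show ?thesis
      unfolding wnorm_eq[of ?h] by (intro real_le_lsqrt) (auto simp: wnorm_eq ip_nonneg)
  qed
  show "\<exists>f\<in>X. (\<lambda>n. N (\<lambda>x. u n x - f x)) \<longlonglongrightarrow> 0"
    if "(\<forall>n. u n \<in> X) \<and> (\<forall>e>0. \<exists>M. \<forall>m\<ge>M. \<forall>n\<ge>M. N (\<lambda>x. u m x - u n x) < e)" for u
    using that by (intro complete) blast+
qed

lemma riesz:
  assumes "\<And>f g. f \<in> X \<Longrightarrow> g \<in> X \<Longrightarrow> l (\<lambda>x. f x + g x) = l f + l g"
    and "\<And>t f. f \<in> X \<Longrightarrow> l (\<lambda>x. t *\<^sub>R f x) = t * l f"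
    and "\<And>f. f \<in> X \<Longrightarrow> \<bar>l f\<bar> \<le> C * N f"
  shows "\<exists>p\<in>X. \<forall>f\<in>X. ip p f = l f"
proof -
  obtain p where "p \<in> X" "\<And>f. f \<in> X \<Longrightarrow> ip p f = l f"
    by (rule riesz_representation_function_space[OF banach wnorm_square ip_commute
          ip_add[OF X_imp_wL2 X_imp_wL2 X_imp_wL2] ip_scale assms]) (assumption | rule that)+
  then show ?thesis by blast
qed

lemma wform_eq_ip: "wform D w f g $ i = ip (\<lambda>y. runit i (f y)) g"
  by (simp add: wform_nth ip_def)

text \<open>
  With \<open>wform_eq_ip\<close>, this moves the component index from the kernel to the function: the component \<open>i\<close> of
  \<open>\<langle>K, g\<rangle>\<close> is the real inner product of \<open>K\<close> with \<open>g cnj(e\<^sub>i)\<close>, whose component 0 is \<open>g\<^sub>i\<close>.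
\<close>

lemma ip_runit: "ip (\<lambda>y. runit i (f y)) g = ip f (\<lambda>y. runit_cnj i (g y))"
  by (simp add: ip_def runit_adjoint)

theorem reproducing: "reproducing_with_projection D w X"
proof -
  have "\<exists>p\<in>X. \<forall>f\<in>X. ip p f = f x $ 0" if x: "x \<in> D" for x
  proof -
    obtain R C where R: "0 < R" and "ball x R \<subseteq> D" "0 \<le> C"
      and b: "\<And>f i y. f \<in> X \<Longrightarrow> y \<in> ball x R \<Longrightarrow> \<bar>f y $ i\<bar> \<le> C * N f"
      and "\<And>f i j y. f \<in> X \<Longrightarrow> y \<in> ball x R \<Longrightarrow> \<bar>partial j (\<lambda>y. f y $ i) y\<bar> \<le> C * N f"
      by (rule local_bound[OF x]) (rule that)
    show ?thesis
      by (rule riesz[where C = C]) (use b R in auto)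
  qed
  then obtain K where K: "\<And>x. x \<in> D \<Longrightarrow> K x \<in> X"
    and rep0: "\<And>x f. x \<in> D \<Longrightarrow> f \<in> X \<Longrightarrow> ip (K x) f = f x $ 0" by metis
  have rep: "ip (\<lambda>y. runit i (K x y)) f = f x $ i" if "x \<in> D" "f \<in> X" for x f i
    using rep0[OF that(1) X_runit_cnj[OF that(2), of i]] by (simp add: ip_runit runit_cnj_nth_0)
  define B where "B x y = tup4 (K x y $ 0) (- K x y $ 1) (- K x y $ 2) (- K x y $ 3)" for x y
  have B: "kernel_tuple B x = K x" for x
    by (rule ext) (simp add: kernel_tuple_def B_def vec_eq_iff all_index4)
  show ?thesis
    unfolding reproducing_with_projection_def
  proof (intro exI[of _ B] conjI ballI; (unfold B)?)
    show "K x \<in> X" if "x \<in> D" for x using K[OF that] .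
    show "wform D w (K x) f = f x" if "x \<in> D" "f \<in> X" for x f
      using rep[OF that] by (simp add: vec_eq_iff wform_eq_ip)
    fix g assume g: "g \<in> wL2 D w"
    have "\<exists>p\<in>X. \<forall>f\<in>X. ip p f = ip g f"
    proof (rule riesz[where C = "N g"])
      show "ip g (\<lambda>x. f x + h x) = ip g f + ip g h" if "f \<in> X" "h \<in> X" for f h
        using ip_add[OF X_imp_wL2[OF that(1)] X_imp_wL2[OF that(2)] g] by (simp only: ip_commute)
      show "ip g (\<lambda>x. t *\<^sub>R f x) = t * ip g f" for t f
        using ip_scale[of t f g] by (simp only: ip_commute)
      show "\<bar>ip g f\<bar> \<le> N g * N f" if "f \<in> X" for f
        by (rule cauchy_schwarz[OF g X_imp_wL2[OF that]])
    qed
    then obtain p where p: "p \<in> X" "\<And>f. f \<in> X \<Longrightarrow> ip p f = ip g f" by blast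
    have "(if x \<in> D then wform D w (K x) g else 0) = p x" for x
    proof (cases "x \<in> D")
      case True
      have "wform D w (K x) g $ i = p x $ i" for i
      proof -
        have "wform D w (K x) g $ i = ip g (\<lambda>y. runit i (K x y))"
          unfolding wform_eq_ip by (rule ip_commute)
        also have "\<dots> = ip p (\<lambda>y. runit i (K x y))"
          by (rule p(2)[OF X_runit[OF K[OF True]], symmetric])
        also have "\<dots> = ip (\<lambda>y. runit i (K x y)) p" by (rule ip_commute)
        finally show ?thesis using rep[OF True p(1)] by simp
      qed
      with True show ?thesis by (simp add: vec_eq_iff)
    qed (simp add: X_outside[OF p(1)])
    then show "(\<lambda>x. if x \<in> D then wform D w (K x) g else 0) \<in> X" using p(1) by simp
  qed
qed

end

section \<open>The potential of the Moebius coefficient\<close>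

lemma bounded_linear_psi: "bounded_linear psi"
proof (rule bounded_linear_intro[where K = 1])
  show "norm (psi x) \<le> norm x * 1" for x
    by (simp add: norm_eq_sqrt_inner inner_real4 norm_quat_def psi_def power2_eq_square)
qed (simp_all add: psi_def quat_arith_defs)

lemma bounded_linear_psi_coords: "bounded_linear psi_coords"
proof (rule bounded_linear_intro[where K = 1])
  show "norm (psi_coords x) \<le> norm x * 1" for x
    by (simp add: norm_eq_sqrt_inner inner_real4 norm_quat_def psi_coords_def power2_eq_square)
qed (simp_all add: psi_coords_def quat_arith_defs vec_eq_iff all_index4)

lemma inner_mult_left_adjoint: "psi_coords (p * u) \<bullet> psi_coords v = psi_coords u \<bullet> psi_coords (qcnj p * v)"
  and inner_mult_right_adjoint: "psi_coords (u * p) \<bullet> psi_coords v = psi_coords u \<bullet> psi_coords (v * qcnj p)"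
  by (simp_all add: psi_coords_def inner_real4 times_quat_def qcnj_def algebra_simps)

text \<open>
  Left and right multiplications by a quaternion have the multiplications by its conjugate as adjoints.
  This turns the derivative of \<open>\<langle>r, T\<^sup>-\<^sup>1 y\<rangle>\<close>, a linear form in \<open>h\<close> of this shape, into a gradient.
\<close>

lemma inner_psi_sandwich: "r \<bullet> psi_coords (p * psi h * s) = psi_coords (qcnj p * psi r * qcnj s) \<bullet> h"
proof -
  have "r \<bullet> psi_coords (p * psi h * s) = psi_coords (p * (psi h * s)) \<bullet> psi_coords (psi r)"
    by (simp add: inner_commute mult.assoc)
  also have "\<dots> = psi_coords (psi h) \<bullet> psi_coords (qcnj p * psi r * qcnj s)"
    by (simp only: inner_mult_left_adjoint[of p] inner_mult_right_adjoint[of "psi h" s])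
  finally show ?thesis by (simp add: inner_commute)
qed

lemma qcnj_mult: "qcnj (u * v) = qcnj v * qcnj u"
  by (simp add: qcnj_def times_quat_def algebra_simps)

lemma qcnj_inverse: "qcnj (inverse u) = u /\<^sub>R (norm u)\<^sup>2"
  by (simp add: qcnj_def inverse_quat_def Let_def norm_quat_def scaleR_quat_def quat_eq_iff divide_inverse mult.commute)

lemma inverse_qcnj: "inverse (qcnj u) = qcnj (inverse u)"
  by (simp add: qcnj_def inverse_quat_def Let_def)

lemma continuous_on_psi [continuous_intros]: "continuous_on S psi"
  by (rule bounded_linear.continuous_on[OF bounded_linear_psi continuous_on_id])

lemma continuous_on_psi_coords [continuous_intros]:
  "continuous_on S f \<Longrightarrow> continuous_on S (\<lambda>x. psi_coords (f x))"
  by (rule bounded_linear.continuous_on[OF bounded_linear_psi_coords])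

definition moebius_inverse :: "quat \<Rightarrow> quat \<Rightarrow> quat \<Rightarrow> quat \<Rightarrow> real^4 \<Rightarrow> real^4"
  where "moebius_inverse a b c d y = psi_coords
    (if c = 0 then inverse a * (psi y * d - b)
     else inverse c * (inverse (psi y - a * inverse c) * moebius_V a b c d - d))"

text \<open>
  The factorization \<open>T x - a c\<^sup>-\<^sup>1 = V (c x + d)\<^sup>-\<^sup>1\<close> shows that for \<open>V \<noteq> 0\<close> the map \<open>T\<close> avoids the value \<open>a c\<^sup>-\<^sup>1\<close>, the pole of
  \<open>\<delta>\<^sub>T\<^sub>,\<^sub>r\<close>, and can be solved for \<open>x\<close> at once.
\<close>

lemma moebius_centred:
  assumes "c \<noteq> 0" "c * psi x + d \<noteq> 0"
  shows "psi (quat_moebius a b c d x) - a * inverse c = moebius_V a b c d * inverse (c * psi x + d)"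
proof -
  let ?Z = "c * psi x + d"
  have "a * inverse c * ?Z = a * psi x + a * inverse c * d"
    using assms(1) by (simp add: distrib_left mult.assoc[symmetric]) (simp add: mult.assoc)
  then have "(psi (quat_moebius a b c d x) - a * inverse c) * ?Z = moebius_V a b c d"
    using assms(2) by (simp add: quat_moebius_def moebius_V_def left_diff_distrib mult.assoc)
  then have "(psi (quat_moebius a b c d x) - a * inverse c) * ?Z * inverse ?Z = moebius_V a b c d * inverse ?Z"
    by simp
  then show ?thesis using assms(2) by (simp add: mult.assoc)
qed

lemma moebius_inverse_moebius:
  assumes "c = 0 \<Longrightarrow> a \<noteq> 0 \<and> d \<noteq> 0" "c \<noteq> 0 \<Longrightarrow> moebius_V a b c d \<noteq> 0" "c * psi x + d \<noteq> 0"
  shows "moebius_inverse a b c d (quat_moebius a b c d x) = x"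
proof (cases "c = 0")
  case True
  then show ?thesis
    using assms(1) by (simp add: moebius_inverse_def quat_moebius_def mult.assoc) (simp add: mult.assoc[symmetric])
next
  case False
  let ?Z = "c * psi x + d" and ?V = "moebius_V a b c d"
  have "inverse (?V * inverse ?Z) * ?V = ?Z"
    using assms(2)[OF False] assms(3) by (simp add: nonzero_inverse_mult_distrib mult.assoc)
  then show ?thesis
    using False by (simp add: moebius_inverse_def moebius_centred[OF False assms(3)] mult.assoc[symmetric])
qed

text \<open>
  For \<open>c \<noteq> 0\<close> and \<open>Y = y - a c\<^sup>-\<^sup>1\<close>, the inverse map is \<open>c\<^sup>-\<^sup>1 (Y\<^sup>-\<^sup>1 V - d)\<close>, and the derivative of \<open>Y\<^sup>-\<^sup>1\<close> in direction \<open>h\<close>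
  is \<open>- Y\<^sup>-\<^sup>1 h Y\<^sup>-\<^sup>1\<close>. Taking adjoints and using \<open>cnj (u\<^sup>-\<^sup>1) = u / |u|\<^sup>2\<close> gives exactly \<open>\<delta>\<^sub>T\<^sub>,\<^sub>r\<close>.
\<close>

lemma moebius_inverse_has_derivative:
  assumes "c = 0 \<or> psi y \<noteq> a * inverse c"
  shows "((\<lambda>y. r \<bullet> moebius_inverse a b c d y) has_derivative (\<lambda>h. delta_T a b c d r y \<bullet> h)) (at y)"
proof (cases "c = 0")
  case True
  have "((\<lambda>y. inverse a * (psi y * d - b)) has_derivative (\<lambda>h. inverse a * psi h * d)) (at y)"
    by (rule derivative_eq_intros bounded_linear_imp_has_derivative[OF bounded_linear_psi] | simp add: mult.assoc)+
  from has_derivative_inner_right[OF bounded_linear.has_derivative[OF bounded_linear_psi_coords this], of r]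
  show ?thesis
    using True by (simp add: inner_psi_sandwich moebius_inverse_def delta_T_def inverse_qcnj)
next
  case False
  let ?Y = "\<lambda>y. psi y - a * inverse c" and ?V = "moebius_V a b c d"
  have Y: "?Y y \<noteq> 0" using assms False by simp
  have "((\<lambda>y. inverse c * (inverse (?Y y) * ?V - d)) has_derivative
      (\<lambda>h. - (inverse c * inverse (?Y y) * psi h * (inverse (?Y y) * ?V)))) (at y)"
    using Y by (auto intro!: derivative_eq_intros bounded_linear_imp_has_derivative[OF bounded_linear_psi]
        simp: mult.assoc)
  from has_derivative_inner_right[OF bounded_linear.has_derivative[OF bounded_linear_psi_coords this], of r]
  have "((\<lambda>y. r \<bullet> moebius_inverse a b c d y) has_derivative
      (\<lambda>h. - (r \<bullet> psi_coords (inverse c * inverse (?Y y) * psi h * (inverse (?Y y) * ?V))))) (at y)"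
    using False by (simp add: moebius_inverse_def bounded_linear.linear[OF bounded_linear_psi_coords, THEN linear_neg])
  moreover have "qcnj (inverse c * inverse (?Y y)) * psi r * qcnj (inverse (?Y y) * ?V) =
      (?Y y * c * psi r * qcnj ?V * ?Y y) /\<^sub>R ((norm c)\<^sup>2 * norm (?Y y) ^ 4)"
    by (simp add: qcnj_mult qcnj_inverse mult.assoc power2_eq_square power4_eq_xxxx)
  ultimately show ?thesis
    using False unfolding inner_psi_sandwich
    by (simp add: delta_T_def Let_def bounded_linear.linear[OF bounded_linear_psi_coords, THEN linear_neg])
qed

lemma continuous_on_moebius_inverse:
  assumes "\<And>y. y \<in> S \<Longrightarrow> c = 0 \<or> psi y \<noteq> a * inverse c"
  shows "continuous_on S (moebius_inverse a b c d)"
proof (cases "c = 0")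
  case True
  then show ?thesis unfolding moebius_inverse_def[abs_def] by (simp, intro continuous_intros)
next
  case False
  then show ?thesis unfolding moebius_inverse_def[abs_def]
    using assms by (simp, intro continuous_intros) auto
qed

lemma continuous_on_delta_T:
  assumes "\<And>y. y \<in> S \<Longrightarrow> c = 0 \<or> psi y \<noteq> a * inverse c"
  shows "continuous_on S (delta_T a b c d r)"
proof (cases "c = 0")
  case True
  then show ?thesis unfolding delta_T_def[abs_def] by simp
next
  case False
  then show ?thesis unfolding delta_T_def[abs_def] Let_def
    using assms by (simp, intro continuous_intros) auto
qed

theorem proposition3p7:
  fixes q r :: "real^4" and \<Omega> \<Xi> :: "(real^4) set" and a b c d :: quat
  assumes "is_domain \<Omega>" and "is_domain \<Xi>"
    and "c = 0 \<Longrightarrow> a \<noteq> 0 \<and> d \<noteq> 0"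
    and "c \<noteq> 0 \<Longrightarrow> moebius_V a b c d \<noteq> 0"
    and "\<And>x. x \<in> \<Xi> \<Longrightarrow> c * psi x + d \<noteq> 0"
    and "bij_betw (quat_moebius a b c d) \<Xi> \<Omega>"
  shows
    "\<forall>(D, \<delta>, w) \<in>
        {(\<Omega>, \<lambda>x. q, lambda_weight q),
         (\<Omega>, delta_T a b c d r, gamma_T \<Xi> a b c d r q),
         (\<Xi>, \<lambda>x. q, rho_T a b c d)}.
       real_banach_space (cimmino_bergman D \<delta> w) (wnorm D w) \<and>
       reproducing_with_projection D w (cimmino_bergman D \<delta> w)"
proof -
  let ?T = "quat_moebius a b c d" and ?S = "moebius_inverse a b c d" and ?V = "moebius_V a b c d"
  have opn: "open \<Omega>" "open \<Xi>" using assms(1,2) by (simp_all add: is_domain_def)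
  have ST: "?S (?T x) = x" if "x \<in> \<Xi>" for x
    using moebius_inverse_moebius[OF assms(3,4) assms(5)[OF that]] .
  have surj: "\<Omega> = ?T ` \<Xi>" and inj: "inj_on ?T \<Xi>" using assms(6) by (auto simp: bij_betw_def)
  have inv: "the_inv_into \<Xi> ?T y = ?S y" if "y \<in> \<Omega>" for y
    using that ST the_inv_into_f_f[OF inj] unfolding surj by auto
  have pole: "c = 0 \<or> psi y \<noteq> a * inverse c" if "y \<in> \<Omega>" for y
  proof (cases "c = 0")
    case False
    from \<open>y \<in> \<Omega>\<close> obtain x where x: "x \<in> \<Xi>" "y = ?T x" unfolding surj by blast
    have "psi y - a * inverse c \<noteq> 0"
      using moebius_centred[OF False assms(5)[OF x(1)], of a b] assms(4)[OF False] assms(5)[OF x(1)] x(2)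
      by simp
    then show ?thesis by simp
  qed simp
  have linear: "((\<lambda>x. q \<bullet> x) has_derivative (\<lambda>h. q \<bullet> h)) (at x)" for x
    by (auto intro!: derivative_eq_intros)
  have 1: "gradient_cimmino \<Omega> (\<lambda>_. q) (\<lambda>x. q \<bullet> x) (lambda_weight q)"
    using opn linear unfolding gradient_cimmino_def lambda_weight_def[abs_def]
    by (auto intro!: continuous_intros)
  have 2: "gradient_cimmino \<Omega> (delta_T a b c d r) (\<lambda>y. r \<bullet> ?S y) (gamma_T \<Xi> a b c d r q)"
  proof
    show "open \<Omega>" by (rule opn)
    show "((\<lambda>y. r \<bullet> ?S y) has_derivative (\<lambda>h. delta_T a b c d r y \<bullet> h)) (at y)" if "y \<in> \<Omega>" for y
      by (rule moebius_inverse_has_derivative[OF pole[OF that]])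
    show "continuous_on \<Omega> (delta_T a b c d r)"
      by (rule continuous_on_delta_T[OF pole])
    have "continuous_on \<Omega> (\<lambda>y. exp (2 * ((r - q) \<bullet> ?S y)))"
      by (intro continuous_intros continuous_on_moebius_inverse pole)
    then show "continuous_on \<Omega> (gamma_T \<Xi> a b c d r q)"
      by (rule continuous_on_eq) (simp add: gamma_T_def inv)
  qed (simp add: gamma_T_def)
  have 3: "gradient_cimmino \<Xi> (\<lambda>_. q) (\<lambda>x. q \<bullet> x) (rho_T a b c d)"
  proof
    have nz: "c * psi x * inverse ?V + d * inverse ?V \<noteq> 0" if "x \<in> \<Xi>" "c \<noteq> 0" for x
      using assms(4)[OF that(2)] assms(5)[OF that(1)] by (simp add: distrib_right[symmetric])
    show "0 < rho_T a b c d x" if "x \<in> \<Xi>" for x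
      using nz[OF that] by (simp add: rho_T_def Let_def)
    show "continuous_on \<Xi> (rho_T a b c d)"
    proof (cases "c = 0")
      case True
      then show ?thesis by (simp add: rho_T_def[abs_def])
    next
      case False
      then show ?thesis using nz unfolding rho_T_def[abs_def] Let_def
        by (simp, intro continuous_intros) auto
    qed
  qed (use opn linear in auto)
  show ?thesis
    using gradient_cimmino.banach[OF 1] gradient_cimmino.reproducing[OF 1]
      gradient_cimmino.banach[OF 2] gradient_cimmino.reproducing[OF 2]
      gradient_cimmino.banach[OF 3] gradient_cimmino.reproducing[OF 3] by simp
qed

end
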